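(* The graded superalgebra $OSym$ is generated by $o:=e_1$ and the elements $e_{2r}$ ($r\ge1$), subject only to the relations $$[e_{2r},e_{2s}]=0,\qquad [o^2,e_{2r}]=0,\qquad [o,e_{2r+2}]=\Big[\tfrac12(oe_{2r}+e_{2r}o),\,e_2\Big]$$ for all $r,s\ge1$, where $[a,b]:=ab-ba$.
   Context: $\Bbbk$ is an algebraically closed field of characteristic $\neq2$. The algebra of odd symmetric functions $OSym$ is the graded superalgebra generated by elements $h_r$ ($r\ge1$) of degree $2r$ and parity $r\bmod 2$, subject to (with $h_0:=1$), for $r\ge0,s\ge1$: $h_rh_s=h_sh_r$ if $r\equiv s\pmod 2$, and $h_rh_s+(-1)^rh_sh_r=(-1)^rh_{r+1}h_{s-1}+h_{s-1}h_{r+1}$ if $r\not\equiv s\pmod 2$. Elements $e_r$ ($r\ge0$) are defined recursively by $\sum_{s=0}^r(-1)^se_sh_{r-s}=\delta_{r,0}$; so $e_r$ has degree $2r$ and parity $r\bmod2$, and $e_1=h_1$. *)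

theory Defs
  imports Main "HOL-Computational_Algebra.Polynomial"
begin

text \<open>Free associative unital algebra over a field 'k on countably many letters
  (indexed by nat): an element is a finitely supported function from words
  (nat lists) to coefficients.  The product is concatenation-convolution.\<close>

type_synonym 'k fa = "nat list \<Rightarrow> 'k"

definition fs :: "'k::field fa \<Rightarrow> bool" where
  "fs f \<longleftrightarrow> finite {w. f w \<noteq> 0}"

definition fa_zero :: "'k::field fa" where "fa_zero = (\<lambda>w. 0)"
definition fa_one :: "'k::field fa" where "fa_one = (\<lambda>w. if w = [] then 1 else 0)"
definition fa_var :: "nat \<Rightarrow> 'k::field fa" where "fa_var i = (\<lambda>w. if w = [i] then 1 else 0)"
definition fa_add :: "'k::field fa \<Rightarrow> 'k fa \<Rightarrow> 'k fa" where "fa_add f g = (\<lambda>w. f w + g w)"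
definition fa_sub :: "'k::field fa \<Rightarrow> 'k fa \<Rightarrow> 'k fa" where "fa_sub f g = (\<lambda>w. f w - g w)"
definition fa_smul :: "'k::field \<Rightarrow> 'k fa \<Rightarrow> 'k fa" where "fa_smul c f = (\<lambda>w. c * f w)"
definition fa_mul :: "'k::field fa \<Rightarrow> 'k fa \<Rightarrow> 'k fa" where
  "fa_mul f g = (\<lambda>w. \<Sum>i\<le>length w. f (take i w) * g (drop i w))"

definition fa_comm :: "'k::field fa \<Rightarrow> 'k fa \<Rightarrow> 'k fa" where
  "fa_comm a b = fa_sub (fa_mul a b) (fa_mul b a)"

inductive_set fa_ideal :: "'k::field fa set \<Rightarrow> 'k fa set" for R where
  gen: "r \<in> R \<Longrightarrow> fs r \<Longrightarrow> r \<in> fa_ideal R"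
| zero: "fa_zero \<in> fa_ideal R"
| add: "a \<in> fa_ideal R \<Longrightarrow> b \<in> fa_ideal R \<Longrightarrow> fa_add a b \<in> fa_ideal R"
| mul: "a \<in> fa_ideal R \<Longrightarrow> fs x \<Longrightarrow> fs y \<Longrightarrow> fa_mul (fa_mul x a) y \<in> fa_ideal R"

fun word_img :: "(nat \<Rightarrow> 'k::field fa) \<Rightarrow> nat list \<Rightarrow> 'k fa" where
  "word_img img [] = fa_one"
| "word_img img (a # w) = fa_mul (img a) (word_img img w)"

definition fa_subst :: "(nat \<Rightarrow> 'k::field fa) \<Rightarrow> 'k fa \<Rightarrow> 'k fa" where
  "fa_subst img y = (\<lambda>v. \<Sum>w\<in>{w. y w \<noteq> 0}. y w * word_img img w v)"

text \<open>OSym = free algebra on letters h_1, h_2, ... (letter i stands for h_(i+1))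
  modulo the ideal of defining relations; h_0 := 1.\<close>
definition hh :: "nat \<Rightarrow> 'k::field fa" where
  "hh r = (if r = 0 then fa_one else fa_var (r - 1))"

definition osym_rels :: "'k::field fa set" where
  "osym_rels =
     {fa_comm (hh r) (hh s) | r s. 1 \<le> s \<and> r mod 2 = s mod 2}
   \<union> {fa_sub (fa_add (fa_mul (hh r) (hh s)) (fa_smul ((-1)^r) (fa_mul (hh s) (hh r))))
             (fa_add (fa_smul ((-1)^r) (fa_mul (hh (r+1)) (hh (s-1)))) (fa_mul (hh (s-1)) (hh (r+1))))
      | r s. 1 \<le> s \<and> r mod 2 \<noteq> s mod 2}"

definition osym_ideal :: "'k::field fa set" where
  "osym_ideal = fa_ideal osym_rels"

text \<open>Representatives of e_r in the free algebra, via
  sum_(s=0..r) (-1)^s e_s h_(r-s) = delta_(r,0).\<close>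
function ee :: "nat \<Rightarrow> 'k::field fa" where
  "ee r = (if r = 0 then fa_one else
      (\<lambda>w. - ((-1)^r) * (\<Sum>s<r. (-1)^s * fa_mul (ee s) (hh (r - s)) w)))"
  by auto
termination by (relation "measure id") auto

text \<open>Presentation algebra: letter 0 stands for o, letter r (r >= 1) for e_(2r).\<close>
definition pres_rels :: "'k::field fa set" where
  "pres_rels =
     {fa_comm (fa_var r) (fa_var s) | r s. 1 \<le> r \<and> 1 \<le> s}
   \<union> {fa_comm (fa_mul (fa_var 0) (fa_var 0)) (fa_var r) | r. 1 \<le> r}
   \<union> {fa_sub (fa_comm (fa_var 0) (fa_var (r+1)))
       (fa_comm (fa_smul (inverse 2) (fa_add (fa_mul (fa_var 0) (fa_var r)) (fa_mul (fa_var r) (fa_var 0))))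
                (fa_var 1))
      | r. 1 \<le> r}"

definition pres_img :: "nat \<Rightarrow> 'k::field fa" where
  "pres_img i = (if i = 0 then ee 1 else ee (2 * i))"

end

theory Submission
  imports Defs "HOL-Computational_Algebra.Formal_Power_Series"
begin

unbundle fps_syntax

text \<open>
  Both quotients of free algebras are turned into rings, and mutually inverse homomorphisms are
  constructed between them, so no basis of $OSym$ is needed.  Two facts about a sequence in an
  arbitrary ring make the homomorphisms well defined.

  First, if $(h_n)$ satisfies the relations of $OSym$, so does the sequence of coefficients of the
  inverse series.  Write $H(T) = a + b$ and $H(U) = c + d$ (even and odd parts).  The relations say
  $ac = ca$, $bd = db$, $T(ad+da) = U(bc+cb)$ and $U(da-ad) = T(bc-cb)$, or equivalently that
  $H(T)(Uc - Td) = (Uc + Td)H(-T)$ and that $H(T)$ commutes with $Tc + Ud$.  These identities can be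
  multiplied by the inverse series on both sides; doing so for $T$ and then for $U$ gives the
  relations for the inverse, because $T^2 - U^2$ and $T^2 + U^2$ are not zero divisors.

  Second, for a sequence $(e_n)$ with $2e_{2r+1} = oe_{2r} + e_{2r}o$, the relations of $OSym$ are
  equivalent to the short list of relations between $o = e_1$ and the $e_{2r}$.  The main point is
  that odd elements commute: $F(m,n) = o D + D o$ with $D = e_m o e_n - e_n o e_m$ ($m, n$ even)
  satisfies $F(m,n+2) = -F(m+2,n)$ and $F(0,n) = [o^2, e_n] = 0$.
\<close>

subsection \<open>Sequences satisfying the relations of odd symmetric functions\<close>

text \<open>With r = \<open>i\<close> and s = \<open>Suc j\<close>, the split by parity makes the
  signs (-1)^r explicit. An arbitrary ring is allowed, so that the predicate serves the
  \<open>h_n\<close>, the \<open>e_n\<close> and the sequences in the presented algebra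
  alike.\<close>

definition osym_seq :: "(nat \<Rightarrow> 'a::ring_1) \<Rightarrow> bool" where
  "osym_seq h \<longleftrightarrow> h 0 = 1
     \<and> (\<forall>i j. even i \<longrightarrow> even j \<longrightarrow> h i * h j = h j * h i)
     \<and> (\<forall>i j. odd i \<longrightarrow> odd j \<longrightarrow> h i * h j = h j * h i)
     \<and> (\<forall>i j. even i \<longrightarrow> even j \<longrightarrow>
          h i * h (Suc j) + h (Suc j) * h i = h j * h (Suc i) + h (Suc i) * h j)
     \<and> (\<forall>i j. odd i \<longrightarrow> odd j \<longrightarrow>
          h i * h (Suc j) - h (Suc j) * h i = h j * h (Suc i) - h (Suc i) * h j)"

lemma osym_seqD:
  assumes "osym_seq h"
  shows "h 0 = 1"
    and "even i \<Longrightarrow> even j \<Longrightarrow> h i * h j = h j * h i"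
    and "odd i \<Longrightarrow> odd j \<Longrightarrow> h i * h j = h j * h i"
    and "even i \<Longrightarrow> even j \<Longrightarrow> h i * h (Suc j) + h (Suc j) * h i = h j * h (Suc i) + h (Suc i) * h j"
    and "odd i \<Longrightarrow> odd j \<Longrightarrow> h i * h (Suc j) - h (Suc j) * h i = h j * h (Suc i) - h (Suc i) * h j"
  using assms unfolding osym_seq_def by iprover+

subsection \<open>The relations pass to the inverse series\<close>

text \<open>The entries of $MN = N'M'$ and of $NM'^{-1} = M^{-1}N'$ for circulant 2-by-2 matrices,
  $M$ having the rows $(a, b)$ and $(b, a)$.\<close>

lemma circulant_conjugate:
  fixes a b c d p q a' b' c' d' p' q' :: "'a::ring_1"
  assumes inv: "p * a + q * b = 1" "p * b + q * a = 0"
    and inv': "a' * p' + b' * q' = 1" "a' * q' + b' * p' = 0"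
    and eq: "a * c + b * d = c' * a' + d' * b'" "a * d + b * c = c' * b' + d' * a'"
  shows "c * p' + d * q' = p * c' + q * d'" "c * q' + d * p' = p * d' + q * c'"
proof -
  \<comment> \<open>By \<open>inv\<close> a factor 1 and a summand 0 are inserted on the left;
    regrouping exposes the left sides of \<open>eq\<close>, and \<open>inv'\<close> finally absorbs
    the primed entries on the right.\<close>
  have "c * p' + d * q' = (p * a + q * b) * (c * p' + d * q') + (p * b + q * a) * (d * p' + c * q')"
    using inv by simp
  also have "\<dots> = p * (a * c + b * d) * p' + p * (a * d + b * c) * q'
      + q * (a * d + b * c) * p' + q * (a * c + b * d) * q'"
    by (simp add: algebra_simps)
  also have "\<dots> = p * c' * (a' * p' + b' * q') + p * d' * (a' * q' + b' * p')
      + q * c' * (a' * q' + b' * p') + q * d' * (a' * p' + b' * q')"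
    unfolding eq by (simp add: algebra_simps)
  finally show "c * p' + d * q' = p * c' + q * d'"
    using inv' by simp
  have "c * q' + d * p' = (p * a + q * b) * (c * q' + d * p') + (p * b + q * a) * (d * q' + c * p')"
    using inv by simp
  also have "\<dots> = p * (a * c + b * d) * q' + p * (a * d + b * c) * p'
      + q * (a * d + b * c) * q' + q * (a * c + b * d) * p'"
    by (simp add: algebra_simps)
  also have "\<dots> = p * c' * (a' * q' + b' * p') + p * d' * (a' * p' + b' * q')
      + q * c' * (a' * p' + b' * q') + q * d' * (a' * q' + b' * p')"
    unfolding eq by (simp add: algebra_simps)
  finally show "c * q' + d * p' = p * d' + q * c'"
    using inv' by simp
qed

text \<open>With \<open>V = U\<close> or \<open>V = - U\<close>, the relations say that \<open>a + b\<close> intertwines \<open>V c \<mp> T d\<close> (up to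
  the sign of \<open>b\<close>) and commutes with \<open>T c + U d\<close>.  Both conditions pass to the inverse \<open>p + q\<close>.\<close>

lemma intertwining_relations_inverse:
  fixes T U V a b c d p q :: "'a::ring_1"
  assumes T: "\<And>z. z * T = T * z" and U: "\<And>z. z * U = U * z" and V: "\<And>z. z * V = V * z"
    and cancelT: "\<And>z. T * z = 0 \<Longrightarrow> z = 0"
    and cancelTUV: "\<And>z. T * (T * z) = U * (V * z) \<Longrightarrow> z = 0"
    and inv: "a * p + b * q = 1" "a * q + b * p = 0" "p * a + q * b = 1" "p * b + q * a = 0"
    and comm: "a * c = c * a" "b * d = d * b"
    and anti: "T * (a * d + d * a) = V * (b * c + c * b)"
    and skew: "U * (d * a - a * d) = T * (b * c - c * b)"
  shows "p * c = c * p" "q * d = d * q"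
    "T * (p * d + d * p) = - V * (q * c + c * q)"
    "U * (d * p - p * d) = T * (q * c - c * q)"
proof -
  have left: "x * (T * z) = T * (x * z)" "x * (U * z) = U * (x * z)" "x * (V * z) = V * (x * z)"
    for x z by (metis T mult.assoc, metis U mult.assoc, metis V mult.assoc)
  have neg: "- (a * q) = b * p"
    using inv(2) by (simp add: neg_eq_iff_add_eq_0)
  \<comment> \<open>Here M' belongs to \<open>a - b\<close>, with inverse \<open>p - q\<close>,
    while N and N' belong to \<open>V * c - T * d\<close> and \<open>V * c + T * d\<close>.\<close>
  have even1: "V * (c * p) + T * (d * q) = V * (p * c) + T * (q * d)"
    and odd1: "- (V * (c * q) + T * (d * p)) = T * (p * d) + V * (q * c)"
    using circulant_conjugate[OF inv(3,4), of a p "- b" "- q" "V * c" "- (T * d)" "V * c" "T * d"]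
      inv(1) neg comm anti by (simp_all add: left mult.assoc algebra_simps)
  \<comment> \<open>Here M' = M, and N = N' belongs to \<open>T * c + U * d\<close>.\<close>
  have even2: "T * (c * p) + U * (d * q) = T * (p * c) + U * (q * d)"
    and odd2: "T * (c * q) + U * (d * p) = U * (p * d) + T * (q * c)"
    using circulant_conjugate[OF inv(3,4,1,2), of "T * c" "U * d" "T * c" "U * d"]
      comm skew by (simp_all add: left mult.assoc algebra_simps)
  have 1: "T * (q * d - d * q) = V * (c * p - p * c)"
    using even1 by (simp add: algebra_simps)
  have 2: "U * (q * d - d * q) = T * (c * p - p * c)"
    using even2 by (simp add: algebra_simps)
  \<comment> \<open>Eliminating the commutator of \<open>c\<close> and \<open>p\<close> between 1
    and 2 leaves an equation to which \<open>cancelTUV\<close> applies.\<close>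
  have "T * (T * (q * d - d * q)) = T * (V * (c * p - p * c))" using 1 by simp
  also have "\<dots> = V * (U * (q * d - d * q))" unfolding 2 by (rule left)
  also have "\<dots> = U * (V * (q * d - d * q))" by (rule left)
  finally have "q * d - d * q = 0" by (rule cancelTUV)
  then show qd: "q * d = d * q" by simp
  with 2 have "T * (c * p - p * c) = 0" by simp
  from cancelT[OF this] show "p * c = c * p" by simp
  show "T * (p * d + d * p) = - V * (q * c + c * q)"
    using odd1 by (simp add: algebra_simps eq_neg_iff_add_eq_0 neg_eq_iff_add_eq_0)
  show "U * (d * p - p * d) = T * (q * c - c * q)"
    using odd2 by (simp add: algebra_simps)
qed

text \<open>The two variables are inverted one after the other: first \<open>a + b\<close> with
  \<open>V = U\<close>, then \<open>c + d\<close> with \<open>T\<close> and \<open>U\<close>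
  exchanged and \<open>V = - T\<close>. The first inversion changes the sign in \<open>anti\<close>
  and the second restores it, so cancellation is required for both T^2 - U^2 and T^2 + U^2.\<close>

lemma osym_generating_functions_inverse:
  fixes T U a b c d p q r s :: "'a::ring_1"
  assumes T: "\<And>z. z * T = T * z" and U: "\<And>z. z * U = U * z"
    and cancelT: "\<And>z. T * z = 0 \<Longrightarrow> z = 0" and cancelU: "\<And>z. U * z = 0 \<Longrightarrow> z = 0"
    and cancel_minus: "\<And>z. T * (T * z) = U * (U * z) \<Longrightarrow> z = 0"
    and cancel_plus: "\<And>z. T * (T * z) = - (U * (U * z)) \<Longrightarrow> z = 0"
    and invT: "a * p + b * q = 1" "a * q + b * p = 0" "p * a + q * b = 1" "p * b + q * a = 0"
    and invU: "c * r + d * s = 1" "c * s + d * r = 0" "r * c + s * d = 1" "r * d + s * c = 0"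
    and comm: "a * c = c * a" "b * d = d * b"
    and anti: "T * (a * d + d * a) = U * (b * c + c * b)"
    and skew: "U * (d * a - a * d) = T * (b * c - c * b)"
  shows "p * r = r * p" "q * s = s * q"
    "T * (p * s + s * p) = U * (q * r + r * q)"
    "U * (s * p - p * s) = T * (q * r - r * q)"
proof -
  note mixed = intertwining_relations_inverse[OF T U U cancelT cancel_minus invT comm anti skew]
  have plus': "z = 0" if "U * (U * z) = T * (- T * z)" for z
    using that by (intro cancel_plus) (simp add: minus_equation_iff)
  have T': "z * - T = - T * z" for z using T[of z] by simp
  have anti': "U * (c * q + q * c) = - T * (d * p + p * d)"
    using mixed(3) by (simp add: algebra_simps eq_neg_iff_add_eq_0)
  note final = intertwining_relations_inverse[OF U T T' cancelU plus' invU mixed(1,2)[symmetric]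
      anti' mixed(4)[symmetric]]
  show "p * r = r * p" "q * s = s * q" using final(1,2) by simp_all
  show "T * (p * s + s * p) = U * (q * r + r * q)" "U * (s * p - p * s) = T * (q * r - r * q)"
    using final(3,4) by (simp_all add: algebra_simps)
qed

section \<open>Generating functions in two variables\<close>

definition even_part :: "(nat \<Rightarrow> 'a::ring_1) \<Rightarrow> 'a fps" where
  "even_part h = Abs_fps (\<lambda>n. if even n then h n else 0)"

definition odd_part :: "(nat \<Rightarrow> 'a::ring_1) \<Rightarrow> 'a fps" where
  "odd_part h = Abs_fps (\<lambda>n. if odd n then h n else 0)"

text \<open>In \<open>'a fps fps\<close> we have the two variables \<open>T = fps_X\<close> and \<open>U = fps_const fps_X\<close>: a series
  \<open>F\<close> in \<open>U\<close> is \<open>fps_const F\<close>, and \<open>fps_outer F\<close> is the same series in \<open>T\<close>.\<close>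

definition fps_outer :: "'a::ring_1 fps \<Rightarrow> 'a fps fps" where
  "fps_outer F = Abs_fps (\<lambda>n. fps_const (F $ n))"

lemma fps_outer_hom:
  "fps_outer 0 = 0" "fps_outer 1 = 1"
  "fps_outer (F + G) = fps_outer F + fps_outer G"
  "fps_outer (F * G) = fps_outer F * fps_outer G"
  by (auto simp: fps_outer_def fps_eq_iff fps_mult_nth fps_sum_nth intro!: sum.cong)

lemma fps_fps_eq_iff: "F = G \<longleftrightarrow> (\<forall>i j. F $ i $ j = G $ i $ j)" for F G :: "'a::ring_1 fps fps"
  by (simp add: fps_eq_iff)

lemma fps_outer_nth: "fps_outer F $ n = fps_const (F $ n)"
  by (simp add: fps_outer_def)

text \<open>Coefficients are compared: the series in \<open>T\<close> carries one index and the
  series in \<open>U\<close> the other, and multiplication by \<open>T\<close> or \<open>U\<close>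
  shifts an index, which aligns products of h_i and h_(j+1) with products of h_(i+1) and
  h_j.\<close>

lemma osym_seq_iff_generating_functions:
  fixes h :: "nat \<Rightarrow> 'a::ring_1"
  defines "a \<equiv> fps_outer (even_part h)" and "b \<equiv> fps_outer (odd_part h)"
    and "c \<equiv> fps_const (even_part h)" and "d \<equiv> fps_const (odd_part h)"
    and "T \<equiv> fps_X" and "U \<equiv> fps_const fps_X"
  shows "osym_seq h \<longleftrightarrow> h 0 = 1 \<and> a * c = c * a \<and> b * d = d * b
    \<and> T * (a * d + d * a) = U * (b * c + c * b)
    \<and> U * (d * a - a * d) = T * (b * c - c * b)"
proof -
  have 1: "a * c = c * a \<longleftrightarrow> (\<forall>i j. even i \<longrightarrow> even j \<longrightarrow> h i * h j = h j * h i)"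
    unfolding a_def c_def by (auto simp: fps_fps_eq_iff fps_outer_nth even_part_def)
  have 2: "b * d = d * b \<longleftrightarrow> (\<forall>i j. odd i \<longrightarrow> odd j \<longrightarrow> h i * h j = h j * h i)"
    unfolding b_def d_def by (auto simp: fps_fps_eq_iff fps_outer_nth odd_part_def)
  have TU: "(T * z) $ i $ j = (if i = 0 then 0 else z $ (i - 1) $ j)"
    "(U * z) $ i $ j = (if j = 0 then 0 else z $ i $ (j - 1))" for z :: "'a fps fps" and i j
    by (simp_all add: T_def U_def)
  have 3: "T * (a * d + d * a) = U * (b * c + c * b) \<longleftrightarrow>
    (\<forall>i j. even i \<longrightarrow> even j \<longrightarrow>
       h i * h (Suc j) + h (Suc j) * h i = h j * h (Suc i) + h (Suc i) * h j)" (is "?L \<longleftrightarrow> ?R")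
  proof
    assume ?L
    then have L: "(T * (a * d + d * a)) $ Suc i $ Suc j = (U * (b * c + c * b)) $ Suc i $ Suc j" for i j
      by simp
    show ?R
    proof (intro allI impI)
      fix i j :: nat
      assume "even i" "even j"
      with L[of i j] show "h i * h (Suc j) + h (Suc j) * h i = h j * h (Suc i) + h (Suc i) * h j"
        unfolding TU
        by (simp add: a_def b_def c_def d_def fps_outer_nth even_part_def odd_part_def add.commute)
    qed
  next
    assume R: ?R
    have "(T * (a * d + d * a)) $ i $ j = (U * (b * c + c * b)) $ i $ j" for i j
      using R[rule_format, of "i - 1" "j - 1"] unfolding TU
      by (cases i; cases j) (auto simp: a_def b_def c_def d_def fps_outer_nth even_part_def odd_part_def)
    then show ?L unfolding fps_fps_eq_iff by blast
  qed
  \<comment> \<open>The two indices are read off in exchanged order. Unlike in 3, there are boundary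
    coefficients: they are commutators with \<open>h 0\<close>, which vanish because
    \<open>h 0 = 1\<close>.\<close>
  have 4: "U * (d * a - a * d) = T * (b * c - c * b) \<longleftrightarrow>
    (\<forall>i j. odd i \<longrightarrow> odd j \<longrightarrow>
       h i * h (Suc j) - h (Suc j) * h i = h j * h (Suc i) - h (Suc i) * h j)" (is "?L \<longleftrightarrow> ?R")
    if h0: "h 0 = 1"
  proof
    assume ?L
    then have L: "(U * (d * a - a * d)) $ Suc j $ Suc i = (T * (b * c - c * b)) $ Suc j $ Suc i" for i j
      by simp
    show ?R
    proof (intro allI impI)
      fix i j :: nat
      assume "odd i" "odd j"
      with L[of i j] show "h i * h (Suc j) - h (Suc j) * h i = h j * h (Suc i) - h (Suc i) * h j"
        unfolding TU
        by (simp add: a_def b_def c_def d_def fps_outer_nth even_part_def odd_part_def)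
    qed
  next
    assume R: ?R
    have "(U * (d * a - a * d)) $ i $ j = (T * (b * c - c * b)) $ i $ j" for i j
      using R[rule_format, of "j - 1" "i - 1"] h0 unfolding TU
      by (cases i; cases j) (auto simp: a_def b_def c_def d_def fps_outer_nth even_part_def odd_part_def)
    then show ?L unfolding fps_fps_eq_iff by blast
  qed
  show ?thesis
    unfolding osym_seq_def 1 2 3 using 4 by (cases "h 0 = 1") (simp_all only: simp_thms)
qed

text \<open>Factors of equal parity contribute to the even degrees of the product and factors of
  opposite parity to the odd ones, where the series 1 has no coefficients.\<close>

lemma parity_parts_inverse:
  fixes h g :: "nat \<Rightarrow> 'a::ring_1"
  assumes "Abs_fps h * Abs_fps g = 1"
  shows "even_part h * even_part g + odd_part h * odd_part g = 1"
    "even_part h * odd_part g + odd_part h * even_part g = 0"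
proof -
  have nth: "(\<Sum>i=0..n. h i * g (n - i)) = (1 :: 'a fps) $ n" for n
    using arg_cong[OF assms, of "\<lambda>F. F $ n"] by (simp add: fps_mult_nth)
  have "(even_part h * even_part g + odd_part h * odd_part g) $ n = (1 :: 'a fps) $ n" for n
  proof -
    have "(even_part h * even_part g + odd_part h * odd_part g) $ n
        = (\<Sum>i=0..n. if even n then h i * g (n - i) else 0)"
      unfolding fps_add_nth fps_mult_nth sum.distrib[symmetric]
      by (intro sum.cong) (auto simp: even_part_def odd_part_def)
    also have "\<dots> = (1 :: 'a fps) $ n" using nth[of n] by (cases "even n") (auto elim: oddE)
    finally show ?thesis .
  qed
  then show "even_part h * even_part g + odd_part h * odd_part g = 1" by (simp add: fps_eq_iff)
  have "(even_part h * odd_part g + odd_part h * even_part g) $ n = 0" for n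
  proof -
    have "(even_part h * odd_part g + odd_part h * even_part g) $ n
        = (\<Sum>i=0..n. if odd n then h i * g (n - i) else 0)"
      unfolding fps_add_nth fps_mult_nth sum.distrib[symmetric]
      by (intro sum.cong) (auto simp: even_part_def odd_part_def)
    also have "\<dots> = 0" using nth[of n] by (cases "odd n") (auto elim: oddE)
    finally show ?thesis .
  qed
  then show "even_part h * odd_part g + odd_part h * even_part g = 0" by (simp add: fps_eq_iff)
qed

text \<open>The coefficient of index \<open>n\<close> reads \<open>V * z $ n = z $ (n - 2)\<close>,
  with right side 0 for \<open>n < 2\<close>, so the coefficients vanish successively. With V = X^2
  and V = -X^2 this covers T^2 - U^2 and T^2 + U^2.\<close>

lemma fps_square_cancel:
  fixes z :: "'a::ring_1 fps fps" and V :: "'a fps"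
  assumes V: "\<And>w. V * w = 0 \<Longrightarrow> w = 0" and eq: "fps_X * (fps_X * z) = fps_const V * z"
  shows "z = 0"
proof -
  have "z $ n = 0" for n
  proof (induction n rule: less_induct)
    case (less n)
    have "V * z $ n = (fps_X * (fps_X * z)) $ n" unfolding eq by simp
    also have "\<dots> = 0" using less by (cases n) auto
    finally show ?case by (rule V)
  qed
  then show ?thesis by (simp add: fps_eq_iff)
qed

lemma fps_X_mult_eq_0D:
  fixes z :: "'a::ring_1 fps"
  assumes "fps_X * z = 0"
  shows "z = 0"
proof (rule fps_ext)
  show "z $ n = 0 $ n" for n
    using arg_cong[OF assms, of "\<lambda>F. F $ Suc n"] by simp
qed

text \<open>Both embeddings \<open>fps_outer\<close> and \<open>fps_const\<close> respect sums and
  products, so the parity-split identities for the inverse hold in \<open>T\<close> as well as in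
  \<open>U\<close>.\<close>

theorem osym_seq_inverse:
  fixes h g :: "nat \<Rightarrow> 'a::ring_1"
  assumes h: "osym_seq h" and hg: "Abs_fps h * Abs_fps g = 1" and gh: "Abs_fps g * Abs_fps h = 1"
  shows "osym_seq g"
proof -
  note gf = h[unfolded osym_seq_iff_generating_functions]
  note inv = parity_parts_inverse[OF hg] parity_parts_inverse[OF gh]
  have invT: "fps_outer (even_part h) * fps_outer (even_part g) + fps_outer (odd_part h) * fps_outer (odd_part g) = 1"
    "fps_outer (even_part h) * fps_outer (odd_part g) + fps_outer (odd_part h) * fps_outer (even_part g) = 0"
    "fps_outer (even_part g) * fps_outer (even_part h) + fps_outer (odd_part g) * fps_outer (odd_part h) = 1"
    "fps_outer (even_part g) * fps_outer (odd_part h) + fps_outer (odd_part g) * fps_outer (even_part h) = 0"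
    using inv by (simp_all flip: fps_outer_hom)
  have invU: "fps_const (even_part h) * fps_const (even_part g) + fps_const (odd_part h) * fps_const (odd_part g) = 1"
    "fps_const (even_part h) * fps_const (odd_part g) + fps_const (odd_part h) * fps_const (even_part g) = 0"
    "fps_const (even_part g) * fps_const (even_part h) + fps_const (odd_part g) * fps_const (odd_part h) = 1"
    "fps_const (even_part g) * fps_const (odd_part h) + fps_const (odd_part g) * fps_const (even_part h) = 0"
    using inv by simp_all
  have T: "z * fps_X = fps_X * z" for z :: "'a fps fps" by (rule fps_mult_fps_X_commute[symmetric])
  have U: "z * fps_const fps_X = fps_const fps_X * z" for z :: "'a fps fps"
    by (rule fps_ext) (simp add: fps_mult_fps_X_commute[symmetric])
  have cancelU: "z = 0" if "fps_const fps_X * z = 0" for z :: "'a fps fps"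
  proof (rule fps_ext)
    show "z $ n = 0 $ n" for n
      using arg_cong[OF that, of "\<lambda>F. F $ n"] fps_X_mult_eq_0D[of "z $ n"] by simp
  qed
  have XX: "z = 0" if "fps_X * (fps_X * z) = 0" for z :: "'a fps"
    using that by (intro fps_X_mult_eq_0D[of z] fps_X_mult_eq_0D[of "fps_X * z"])
  have cancel: "z = 0" if "fps_X * (fps_X * z) = fps_const fps_X * (fps_const fps_X * z)" for z :: "'a fps fps"
    by (rule fps_square_cancel[of "fps_X * fps_X"])
      (simp_all only: XX that mult.assoc flip: fps_const_mult)
  have cancel': "z = 0" if "fps_X * (fps_X * z) = - (fps_const fps_X * (fps_const fps_X * z))" for z :: "'a fps fps"
    by (rule fps_square_cancel[of "- (fps_X * fps_X)"])
      (simp_all only: XX that mult.assoc mult_minus_left neg_equal_0_iff_equal flip: fps_const_mult fps_const_neg)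
  have "h 0 * g 0 = 1" using arg_cong[OF hg, of "\<lambda>F. F $ 0"] by simp
  with gf have g0: "g 0 = 1" by simp
  show ?thesis
    unfolding osym_seq_iff_generating_functions
    by (intro conjI g0 osym_generating_functions_inverse[OF T U fps_X_mult_eq_0D cancelU cancel cancel' invT invU])
      (use gf in \<open>simp_all only:\<close>)
qed

text \<open>Within each relation all products have index sums of the same parity and thus change by
  the same sign. This passes between \<open>e_n\<close> and (-1)^n \<open>e_n\<close>; the latter
  forms the inverse series of the \<open>h_n\<close>.\<close>

lemma osym_seq_sign:
  fixes h :: "nat \<Rightarrow> 'a::ring_1"
  assumes "osym_seq h"
  shows "osym_seq (\<lambda>n. (- 1) ^ n * h n)"
proof -
  have "- (h i * h (Suc j)) - h (Suc j) * h i = - (h j * h (Suc i)) - h (Suc i) * h j"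
    if "even i" "even j" for i j
  proof -
    have "- (h i * h (Suc j) + h (Suc j) * h i) = - (h j * h (Suc i) + h (Suc i) * h j)"
      using assms that by (simp add: osym_seq_def)
    then show ?thesis by simp
  qed
  moreover have "h (Suc j) * h i - h i * h (Suc j) = h (Suc i) * h j - h j * h (Suc i)"
    if "odd i" "odd j" for i j
  proof -
    have "- (h i * h (Suc j) - h (Suc j) * h i) = - (h j * h (Suc i) - h (Suc i) * h j)"
      using assms that unfolding osym_seq_def neg_equal_iff_equal by blast
    then show ?thesis by simp
  qed
  ultimately show ?thesis
    using assms unfolding osym_seq_def by (simp add: uminus_power_if)
qed

section \<open>Sequences linked by the recursion for the \<open>e_n\<close>: transfer of relations,
  existence and uniqueness\<close>

definition inverse_seq :: "(nat \<Rightarrow> 'a::ring_1) \<Rightarrow> (nat \<Rightarrow> 'a) \<Rightarrow> bool" where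
  "inverse_seq e h \<longleftrightarrow> (\<forall>r. (\<Sum>s\<le>r. (- 1) ^ s * e s * h (r - s)) = (if r = 0 then 1 else 0))"

lemma inverse_seq_iff_fps:
  "inverse_seq e h \<longleftrightarrow> Abs_fps (\<lambda>n. (- 1) ^ n * e n) * Abs_fps h = 1"
  by (simp add: inverse_seq_def fps_eq_iff fps_mult_nth atLeast0AtMost)

text \<open>Constant term 1 gives \<open>G\<close> a right inverse, and by associativity this
  coincides with the left inverse \<open>F\<close>.\<close>

lemma fps_left_inverse_imp_right_inverse:
  fixes F G :: "'a::ring_1 fps"
  assumes "F * G = 1" "G $ 0 = 1"
  shows "G * F = 1"
proof -
  have "G * fps_right_inverse G 1 = 1"
    using assms(2) by (intro fps_right_inverse) simp
  then show ?thesis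
    using assms(1) by (metis mult.assoc mult_1_left mult_1_right)
qed

lemma osym_seq_inverse_seq:
  assumes h: "osym_seq h" and eh: "inverse_seq e h"
  shows "osym_seq e"
proof -
  have "h 0 = 1" using h by (simp add: osym_seq_def)
  note eh' = eh[unfolded inverse_seq_iff_fps]
  have "osym_seq (\<lambda>n. (- 1) ^ n * e n)"
    using fps_left_inverse_imp_right_inverse[OF eh'] \<open>h 0 = 1\<close> by (intro osym_seq_inverse[OF h _ eh']) simp
  \<comment> \<open>The sign twist is an involution.\<close>
  from osym_seq_sign[OF this] show ?thesis
    by (simp flip: mult.assoc power_add)
qed

text \<open>Used in the presented algebra, where candidates for the \<open>e_n\<close> are given and
  the \<open>h_n\<close> have to be constructed.\<close>

lemma osym_seq_ex_inverse_seq: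
  assumes e: "osym_seq e"
  obtains h where "osym_seq h" "inverse_seq e h"
proof
  define G where "G = Abs_fps (\<lambda>n. (- 1) ^ n * e n)"
  define h where "h n = fps_right_inverse G 1 $ n" for n
  have G0: "G $ 0 = 1" using e by (simp add: G_def osym_seq_def)
  have h: "G * Abs_fps h = 1"
    unfolding h_def fps_nth_inverse using G0 by (intro fps_right_inverse) simp
  then show "inverse_seq e h" by (simp add: inverse_seq_iff_fps G_def)
  have "h 0 = 1" using arg_cong[OF h, of "\<lambda>F. F $ 0"] G0 by simp
  then show "osym_seq h"
    using osym_seq_inverse[OF osym_seq_sign[OF e]] h fps_left_inverse_imp_right_inverse[OF h]
    by (simp add: G_def)
qed

text \<open>A left and a right inverse of the same series agree. Hence a homomorphism known on the
  \<open>h_n\<close> can be computed on the \<open>e_n\<close>; the next uniqueness lemma serves the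
  opposite direction.\<close>

lemma inverse_seq_unique_left:
  assumes e: "inverse_seq e h" and e': "inverse_seq e' h" and h0: "h 0 = 1"
  shows "e = e'"
proof
  fix n
  let ?F = "Abs_fps (\<lambda>n. (- 1) ^ n * e n)" and ?F' = "Abs_fps (\<lambda>n. (- 1) ^ n * e' n)"
  have "Abs_fps h * ?F = 1"
    using fps_left_inverse_imp_right_inverse[of ?F "Abs_fps h"] e h0 by (simp add: inverse_seq_iff_fps)
  then have "?F' = (?F' * Abs_fps h) * ?F" by (simp add: mult.assoc)
  also have "\<dots> = ?F" using e' by (simp add: inverse_seq_iff_fps)
  finally have "?F' $ n = ?F $ n" by (rule arg_cong)
  then show "e n = e' n" by (simp add: uminus_power_if split: if_splits)
qed

lemma inverse_seq_unique_right:
  assumes h: "inverse_seq e h" and h': "inverse_seq e h'" and h0: "h 0 = 1"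
  shows "h = h'"
proof
  fix n
  let ?F = "Abs_fps (\<lambda>n. (- 1) ^ n * e n)"
  have "Abs_fps h * ?F = 1"
    using fps_left_inverse_imp_right_inverse[of ?F "Abs_fps h"] h h0 by (simp add: inverse_seq_iff_fps)
  then have "Abs_fps h' = Abs_fps h * (?F * Abs_fps h')" by (simp flip: mult.assoc)
  also have "\<dots> = Abs_fps h" using h' by (simp add: inverse_seq_iff_fps)
  finally have "Abs_fps h' $ n = Abs_fps h $ n" by (rule arg_cong)
  then show "h n = h' n" by simp
qed

subsection \<open>The reduced list of relations\<close>

text \<open>These are specialisations to an index 0 or 1, except the third, which doubles the
  commutation of \<open>e 1\<close> with the odd \<open>e (Suc n)\<close> and inserts the
  second.\<close>

lemma osym_seq_reduced:
  fixes e :: "nat \<Rightarrow> 'a::ring_1"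
  assumes e: "osym_seq e"
  shows "even m \<Longrightarrow> even n \<Longrightarrow> e m * e n = e n * e m"
    and "even n \<Longrightarrow> e (Suc n) + e (Suc n) = e 1 * e n + e n * e 1"
    and "even n \<Longrightarrow> e 1 * e 1 * e n = e n * (e 1 * e 1)"
    and "even n \<Longrightarrow> e 1 * e (Suc (Suc n)) - e (Suc (Suc n)) * e 1 = e (Suc n) * e 2 - e 2 * e (Suc n)"
proof -
  show "even m \<Longrightarrow> even n \<Longrightarrow> e m * e n = e n * e m"
    using e by (simp add: osym_seq_def)
  show double: "e (Suc n) + e (Suc n) = e 1 * e n + e n * e 1" if "even n" for n
  proof -
    have "e 0 * e (Suc n) + e (Suc n) * e 0 = e n * e (Suc 0) + e (Suc 0) * e n"
      using e that unfolding osym_seq_def by blast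
    moreover have "e 0 = 1" using e by (simp add: osym_seq_def)
    ultimately show ?thesis by (simp add: add.commute)
  qed
  show "e 1 * e 1 * e n = e n * (e 1 * e 1)" if "even n"
  proof -
    have "e 1 * e (Suc n) = e (Suc n) * e 1"
      using e that unfolding osym_seq_def by simp
    then have "e 1 * (e (Suc n) + e (Suc n)) = (e (Suc n) + e (Suc n)) * e 1"
      by (simp add: algebra_simps)
    then show ?thesis unfolding double[OF that] by (simp add: algebra_simps)
  qed
  show "e 1 * e (Suc (Suc n)) - e (Suc (Suc n)) * e 1 = e (Suc n) * e 2 - e 2 * e (Suc n)" if "even n"
  proof -
    have "e 1 * e (Suc (Suc n)) - e (Suc (Suc n)) * e 1 = e (Suc n) * e (Suc 1) - e (Suc 1) * e (Suc n)"
      using e that unfolding osym_seq_def by (meson even_Suc odd_one)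
    then show ?thesis by (simp add: numeral_2_eq_2)
  qed
qed

text \<open>By \<open>double\<close>, each family becomes, after doubling its odd elements, an
  identity in \<open>u\<close> and the commuting even elements. The two families of mixed parity
  then amount to a symmetry in \<open>m\<close> and \<open>n\<close>.\<close>

lemma osym_seqI_reduced:
  fixes e :: "nat \<Rightarrow> 'a::ring_1"
  assumes two: "\<And>z::'a. z + z = 0 \<Longrightarrow> z = 0" and e0: "e 0 = 1"
    and comm: "\<And>m n. even m \<Longrightarrow> even n \<Longrightarrow> e m * e n = e n * e m"
    and double: "\<And>n. even n \<Longrightarrow> e (Suc n) + e (Suc n) = e 1 * e n + e n * e 1"
    and square: "\<And>n. even n \<Longrightarrow> e 1 * e 1 * e n = e n * (e 1 * e 1)"
    and skew: "\<And>n. even n \<Longrightarrow> e 1 * e (Suc (Suc n)) - e (Suc (Suc n)) * e 1 = e (Suc n) * e 2 - e 2 * e (Suc n)"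
  shows "osym_seq e"
proof -
  define u where "u = e 1"
  have cancel2: "x = y" if "x + x = y + y" for x y :: 'a
    using two[of "x - y"] that by (simp add: algebra_simps)
  have comm_left: "e m * (e n * z) = e n * (e m * z)" if "even m" "even n" for m n z
    using comm[OF that] by (metis mult.assoc)
  have anti: "e m * e (Suc n) + e (Suc n) * e m = e n * e (Suc m) + e (Suc m) * e n"
    if "even m" "even n" for m n
  proof (rule cancel2)
    have "e m * e (Suc n) + e (Suc n) * e m + (e m * e (Suc n) + e (Suc n) * e m)
        = e m * (e (Suc n) + e (Suc n)) + (e (Suc n) + e (Suc n)) * e m"
      by (simp add: algebra_simps)
    also have "\<dots> = e n * (e (Suc m) + e (Suc m)) + (e (Suc m) + e (Suc m)) * e n"
      using that by (simp add: double comm[OF that] comm_left[OF that] algebra_simps)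
    finally show "e m * e (Suc n) + e (Suc n) * e m + (e m * e (Suc n) + e (Suc n) * e m)
        = e n * e (Suc m) + e (Suc m) * e n + (e n * e (Suc m) + e (Suc m) * e n)"
      by (simp add: algebra_simps)
  qed
  text \<open>Left and right multiplications by the \<open>e n\<close> with \<open>n\<close> even all commute, so the third
    family of relations turns the left-hand side into an expression symmetric in \<open>m\<close> and \<open>n\<close>.\<close>
  have skew4: "(u * e m + e m * u) * e (Suc (Suc n)) - e (Suc (Suc n)) * (u * e m + e m * u)
      = (u * e n + e n * u) * e (Suc (Suc m)) - e (Suc (Suc m)) * (u * e n + e n * u)"
    if m: "even m" and n: "even n" for m n
  proof (rule cancel2)
    define S where "S n = u * e n + e n * u" for n
    have skew2: "u * e (Suc (Suc n)) - e (Suc (Suc n)) * u + (u * e (Suc (Suc n)) - e (Suc (Suc n)) * u)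
        = S n * e 2 - e 2 * S n" if "even n" for n
    proof -
      have "u * e (Suc (Suc n)) - e (Suc (Suc n)) * u + (u * e (Suc (Suc n)) - e (Suc (Suc n)) * u)
          = (e (Suc n) + e (Suc n)) * e 2 - e 2 * (e (Suc n) + e (Suc n))"
        using skew[OF that] by (simp add: u_def algebra_simps)
      then show ?thesis unfolding double[OF that] by (simp add: u_def S_def)
    qed
    \<comment> \<open>As \<open>e m\<close> commutes with \<open>e (Suc (Suc n))\<close>, it can be
      moved outside the commutator; what remains is the commutator with \<open>u\<close>, which
      \<open>skew2\<close> rewrites.\<close>
    have expand: "S m * e (Suc (Suc n)) - e (Suc (Suc n)) * S m + (S m * e (Suc (Suc n)) - e (Suc (Suc n)) * S m)
      = (u * e n * e 2 + e n * u * e 2 - e 2 * u * e n - e 2 * e n * u) * e m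
      + e m * (u * e n * e 2 + e n * u * e 2 - e 2 * u * e n - e 2 * e n * u)"
      if m: "even m" and n: "even n" for m n
    proof -
      have "S m * e (Suc (Suc n)) - e (Suc (Suc n)) * S m + (S m * e (Suc (Suc n)) - e (Suc (Suc n)) * S m)
        = (u * e (Suc (Suc n)) - e (Suc (Suc n)) * u + (u * e (Suc (Suc n)) - e (Suc (Suc n)) * u)) * e m
        + e m * (u * e (Suc (Suc n)) - e (Suc (Suc n)) * u + (u * e (Suc (Suc n)) - e (Suc (Suc n)) * u))"
        using m n by (simp add: S_def comm[of m "Suc (Suc n)"] comm_left[of m "Suc (Suc n)"] algebra_simps)
      then show ?thesis unfolding skew2[OF n] by (simp add: S_def algebra_simps)
    qed
    show "S m * e (Suc (Suc n)) - e (Suc (Suc n)) * S m + (S m * e (Suc (Suc n)) - e (Suc (Suc n)) * S m)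
      = S n * e (Suc (Suc m)) - e (Suc (Suc m)) * S n + (S n * e (Suc (Suc m)) - e (Suc (Suc m)) * S n)"
      unfolding expand[OF m n] expand[OF n m]
      using m n by (simp add: comm[of m n] comm_left[of m n] comm[of m 2] comm_left[of m 2]
        comm[of n 2] comm_left[of n 2] algebra_simps)
  qed
  have skew': "e (Suc m) * e (Suc (Suc n)) - e (Suc (Suc n)) * e (Suc m)
      = e (Suc n) * e (Suc (Suc m)) - e (Suc (Suc m)) * e (Suc n)" if "even m" "even n" for m n
    using skew4[OF that, unfolded u_def double[OF that(1), symmetric] double[OF that(2), symmetric]]
    by - (rule cancel2, simp add: algebra_simps)
  have usq: "u * (u * e n) = e n * (u * u)" "u * (u * (e n * z)) = e n * (u * (u * z))"
    if "even n" for n z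
    using square[OF that] arg_cong[OF square[OF that], of "\<lambda>x. x * z"]
    unfolding u_def mult.assoc .
  \<comment> \<open>For even \<open>m\<close> and \<open>n\<close>, \<open>F m n\<close> is the
    commutator of \<open>u * e m + e m * u\<close> and \<open>u * e n + e n * u\<close>; the other
    terms cancel since \<open>u * u\<close> commutes with the even elements.\<close>
  define D where "D m n = e m * u * e n - e n * u * e m" for m n
  define F where "F m n = u * D m n + D m n * u" for m n
  have F_step: "F m (Suc (Suc n)) = - F (Suc (Suc m)) n" if m: "even m" and n: "even n" for m n
  proof -
    \<comment> \<open>The sum becomes a difference of commutators [u, x] with x a product of two
      even elements, and u[u, x] + [u, x]u = [u^2, x] = 0.\<close>
    have D_sum: "D m (Suc (Suc n)) + D (Suc (Suc m)) n = (u * (e n * e (Suc (Suc m))) - e n * e (Suc (Suc m)) * u)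
       - (u * (e m * e (Suc (Suc n))) - e m * e (Suc (Suc n)) * u)"
      using skew4[OF m n] m n
      by (simp add: D_def comm[of "Suc (Suc n)" m] comm[of "Suc (Suc m)" n]
        comm_left[of "Suc (Suc n)" m] comm_left[of "Suc (Suc m)" n] algebra_simps)
    have twice: "u * (u * (e i * e j) - e i * e j * u) + (u * (e i * e j) - e i * e j * u) * u = 0"
      if "even i" "even j" for i j
      using that by (simp add: algebra_simps usq)
    have "F m (Suc (Suc n)) + F (Suc (Suc m)) n
        = u * (D m (Suc (Suc n)) + D (Suc (Suc m)) n) + (D m (Suc (Suc n)) + D (Suc (Suc m)) n) * u"
      by (simp add: F_def algebra_simps)
    also have "\<dots> = 0"
      unfolding D_sum using twice[of n "Suc (Suc m)"] twice[of m "Suc (Suc n)"] m n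
      by (simp add: algebra_simps)
    finally show ?thesis by (simp add: eq_neg_iff_add_eq_0)
  qed
  have F_0: "F 0 n = 0" if "even n" for n
    using that by (simp add: F_def D_def e0 algebra_simps usq)
  have F_zero: "F (2 * m) n = 0" if "even n" for m n
    using that
  proof (induction m arbitrary: n)
    case (Suc m)
    then show ?case using F_step[of "2 * m" n] by simp
  qed (simp add: F_0)
  have oddcomm: "e (Suc m) * e (Suc n) = e (Suc n) * e (Suc m)" if m: "even m" and n: "even n" for m n
  \<comment> \<open>One factor 2 is cancelled for each of the two odd elements.\<close>
  proof (rule cancel2)
    show "e (Suc m) * e (Suc n) + e (Suc m) * e (Suc n) = e (Suc n) * e (Suc m) + e (Suc n) * e (Suc m)"
    proof (rule cancel2)
      have "F m n = 0" using F_zero[OF n, of "m div 2"] m by simp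
      then have "(u * e m + e m * u) * (u * e n + e n * u) = (u * e n + e n * u) * (u * e m + e m * u)"
        using m n by (simp add: F_def D_def usq comm[of m n] comm_left[of m n] algebra_simps)
      then show "e (Suc m) * e (Suc n) + e (Suc m) * e (Suc n) + (e (Suc m) * e (Suc n) + e (Suc m) * e (Suc n))
        = e (Suc n) * e (Suc m) + e (Suc n) * e (Suc m) + (e (Suc n) * e (Suc m) + e (Suc n) * e (Suc m))"
        unfolding u_def double[OF m, symmetric] double[OF n, symmetric] by (simp add: algebra_simps)
    qed
  qed
  show ?thesis
    unfolding osym_seq_def
  proof (intro conjI allI impI)
    fix i j :: nat
    show "e i * e j = e j * e i" if "even i" "even j" using comm that .
    show "e i * e (Suc j) + e (Suc j) * e i = e j * e (Suc i) + e (Suc i) * e j" if "even i" "even j"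
      using anti that .
    show "e i * e j = e j * e i" if "odd i" "odd j"
      using oddcomm[of "i - 1" "j - 1"] that by (cases i; cases j) auto
    show "e i * e (Suc j) - e (Suc j) * e i = e j * e (Suc i) - e (Suc i) * e j" if "odd i" "odd j"
      using skew'[of "i - 1" "j - 1"] that by (cases i; cases j) auto
  qed (rule e0)
qed

subsection \<open>The free algebra\<close>

declare ee.simps [simp del]

lemma fs_zero: "fs fa_zero"
  by (simp add: fs_def fa_zero_def)

lemma fs_one: "fs fa_one"
  by (simp add: fs_def fa_one_def)

lemma fs_var: "fs (fa_var i)"
  by (simp add: fs_def fa_var_def)

lemma fs_add: "fs f \<Longrightarrow> fs g \<Longrightarrow> fs (fa_add f g)"
  unfolding fs_def fa_add_def by (rule finite_subset[of _ "{w. f w \<noteq> 0} \<union> {w. g w \<noteq> 0}"]) auto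

lemma fs_sub: "fs f \<Longrightarrow> fs g \<Longrightarrow> fs (fa_sub f g)"
  unfolding fs_def fa_sub_def by (rule finite_subset[of _ "{w. f w \<noteq> 0} \<union> {w. g w \<noteq> 0}"]) auto

lemma fs_smul: "fs f \<Longrightarrow> fs (fa_smul c f)"
  unfolding fs_def fa_smul_def by (rule finite_subset[of _ "{w. f w \<noteq> 0}"]) auto

lemma fs_mul:
  assumes "fs f" "fs g"
  shows "fs (fa_mul f g)"
  unfolding fs_def
proof (rule finite_subset)
  show "{w. fa_mul f g w \<noteq> 0} \<subseteq> (\<lambda>(u, v). u @ v) ` ({w. f w \<noteq> 0} \<times> {w. g w \<noteq> 0})"
  proof
    fix w assume "w \<in> {w. fa_mul f g w \<noteq> 0}"
    then obtain i where "f (take i w) * g (drop i w) \<noteq> 0"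
      unfolding fa_mul_def by (auto elim: sum.not_neutral_contains_not_neutral)
    then show "w \<in> (\<lambda>(u, v). u @ v) ` ({w. f w \<noteq> 0} \<times> {w. g w \<noteq> 0})"
      by (intro image_eqI[of _ _ "(take i w, drop i w)"]) auto
  qed
qed (use assms in \<open>simp add: fs_def\<close>)

lemma fs_hh: "fs (hh r)"
  by (simp add: hh_def fs_one fs_var)

lemma fs_comm: "fs f \<Longrightarrow> fs g \<Longrightarrow> fs (fa_comm f g)"
  by (simp add: fa_comm_def fs_sub fs_mul)

lemmas fs_intros = fs_zero fs_one fs_var fs_add fs_sub fs_smul fs_mul fs_hh fs_comm

lemma fa_sum_insert:
  assumes "finite S" "i \<notin> S"
  shows "(\<lambda>w. \<Sum>j\<in>insert i S. c j * F j w) = fa_add (fa_smul (c i) (F i)) (\<lambda>w. \<Sum>j\<in>S. c j * F j w)"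
  using assms by (simp add: fa_add_def fa_smul_def)

lemma fs_sum:
  assumes "finite S" "\<And>i. i \<in> S \<Longrightarrow> fs (F i)"
  shows "fs (\<lambda>w. \<Sum>i\<in>S. c i * F i w)"
  using assms
proof (induction S rule: finite_induct)
  case empty
  then show ?case using fs_zero by (simp add: fa_zero_def)
next
  case (insert i S)
  then show ?case unfolding fa_sum_insert[OF insert.hyps] by (intro fs_intros) auto
qed

lemma ee_0: "ee 0 = fa_one"
  by (simp add: ee.simps[of 0])

lemma fs_ee: "fs (ee r :: 'k::field fa)"
proof (induction r rule: less_induct)
  case (less r)
  show ?case
  proof (cases "r = 0")
    case True
    then show ?thesis by (simp add: ee_0 fs_one)
  next
    case False
    have "fs (\<lambda>w. \<Sum>s<r. (- 1) ^ s * fa_mul (ee s) (hh (r - s) :: 'k fa) w)"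
      using less by (intro fs_sum fs_mul fs_hh) auto
    from fs_smul[OF this, of "- ((- 1) ^ r)"] False show ?thesis
      by (simp add: ee.simps[of r] fa_smul_def)
  qed
qed

lemma fa_mul_assoc: "fa_mul (fa_mul f g) h = fa_mul f (fa_mul g h)"
proof
  fix w :: "nat list"
  let ?n = "length w"
  \<comment> \<open>Two cuts divide \<open>w\<close> into blocks of lengths \<open>i\<close>,
    \<open>k\<close> and \<open>l\<close>, which gives the triple sum the shape of
    \<open>fps_mult_assoc_lemma\<close>.\<close>
  let ?F = "\<lambda>i k l. f (take i w) * g (take k (drop i w)) * h (drop (i + k) w)"
  have "fa_mul (fa_mul f g) h w = (\<Sum>j=0..?n. \<Sum>i=0..j. ?F i (j - i) (?n - j))"
    unfolding fa_mul_def
    by (auto simp: sum_distrib_right atLeast0AtMost drop_take min_def intro!: sum.cong)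
  also have "\<dots> = (\<Sum>j=0..?n. \<Sum>i=0..?n - j. ?F j i (?n - j - i))"
    by (rule fps_mult_assoc_lemma)
  also have "\<dots> = fa_mul f (fa_mul g h) w"
    unfolding fa_mul_def
    by (auto simp: sum_distrib_left atLeast0AtMost mult.assoc add.commute intro!: sum.cong)
  finally show "fa_mul (fa_mul f g) h w = fa_mul f (fa_mul g h) w" .
qed

lemma fa_mul_one: "fa_mul fa_one f = f" "fa_mul f fa_one = f"
proof -
  have "fa_mul fa_one f w = (\<Sum>i\<le>length w. if i = 0 then f w else 0)" for w
    unfolding fa_mul_def fa_one_def by (intro sum.cong) auto
  then show "fa_mul fa_one f = f" by auto
  have "fa_mul f fa_one w = (\<Sum>i\<le>length w. if i = length w then f w else 0)" for w
    unfolding fa_mul_def fa_one_def by (intro sum.cong) auto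
  then show "fa_mul f fa_one = f" by auto
qed

lemma fa_mul_linear:
  "fa_mul fa_zero g = fa_zero" "fa_mul g fa_zero = fa_zero"
  "fa_mul (fa_add f f') g = fa_add (fa_mul f g) (fa_mul f' g)"
  "fa_mul g (fa_add f f') = fa_add (fa_mul g f) (fa_mul g f')"
  "fa_mul (fa_sub f f') g = fa_sub (fa_mul f g) (fa_mul f' g)"
  "fa_mul g (fa_sub f f') = fa_sub (fa_mul g f) (fa_mul g f')"
  "fa_mul (fa_smul c f) g = fa_smul c (fa_mul f g)"
  "fa_mul g (fa_smul c f) = fa_smul c (fa_mul g f)"
  by (auto simp: fa_mul_def fa_add_def fa_sub_def fa_smul_def fa_zero_def sum.distrib sum_subtractf
      sum_distrib_left algebra_simps)

section \<open>Monomials and substitution as an algebra homomorphism\<close>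

definition fa_mono :: "nat list \<Rightarrow> 'k::field fa" where
  "fa_mono w = (\<lambda>v. if v = w then 1 else 0)"

lemma fs_mono: "fs (fa_mono w)"
  by (simp add: fs_def fa_mono_def)

lemma fa_mono_Nil: "fa_mono [] = fa_one"
  by (simp add: fa_mono_def fa_one_def)

lemma fa_mono_Cons: "fa_mono (a # w) = fa_mul (fa_var a) (fa_mono w)"
proof
  fix v
  have "fa_mul (fa_var a) (fa_mono w) v = (\<Sum>i\<le>length v. if i = 1 then fa_mono (a # w) v else 0)"
    unfolding fa_mul_def
  proof (intro sum.cong refl)
    fix i assume i: "i \<in> {..length v}"
    show "fa_var a (take i v) * fa_mono w (drop i v) = (if i = 1 then fa_mono (a # w) v else 0)"
    proof (cases "i = 1")
      case True
      then show ?thesis using i by (cases v) (auto simp: fa_var_def fa_mono_def)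
    next
      case False
      then have "length (take i v) \<noteq> length [a]" using i by simp
      then have "take i v \<noteq> [a]" by metis
      then show ?thesis using False by (simp add: fa_var_def)
    qed
  qed
  then show "fa_mono (a # w) v = fa_mul (fa_var a) (fa_mono w) v"
    by (auto simp: fa_mono_def)
qed

lemma fa_mono_append: "fa_mono (u @ v) = fa_mul (fa_mono u) (fa_mono v)"
  by (induction u) (simp_all add: fa_mono_Nil fa_mono_Cons fa_mul_one fa_mul_assoc)

text \<open>A finitely supported function is the sum of the scaled monomials over its support, so
  linear statements reduce to words.\<close>

lemma fs_induct [consumes 1, case_names zero add]:
  assumes "fs f" and zero: "P fa_zero"
    and add: "\<And>f c w. fs f \<Longrightarrow> P f \<Longrightarrow> P (fa_add (fa_smul c (fa_mono w)) f)"
  shows "P f"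
proof -
  have *: "P (\<lambda>v. \<Sum>w\<in>S. f w * fa_mono w v)" if "finite S" for S
    using that
  proof (induction S rule: finite_induct)
    case empty
    then show ?case using zero by (simp add: fa_zero_def)
  next
    case (insert w S)
    then show ?case
      unfolding fa_sum_insert[OF insert.hyps] by (intro add fs_sum fs_mono)
  qed
  have "(\<lambda>v. \<Sum>w\<in>{w. f w \<noteq> 0}. f w * fa_mono w v) = f"
    using assms(1) by (auto simp: fs_def fa_mono_def fun_eq_iff if_distrib cong: if_cong)
  with *[of "{w. f w \<noteq> 0}"] assms(1) show ?thesis by (simp add: fs_def)
qed

text \<open>Additivity needs one index set for both summands and their sum, whose support may shrink
  by cancellation.\<close>

lemma fa_subst_eq_sum:
  assumes "finite S" "\<And>w. y w \<noteq> 0 \<Longrightarrow> w \<in> S"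
  shows "fa_subst g y = (\<lambda>v. \<Sum>w\<in>S. y w * word_img g w v)"
  unfolding fa_subst_def using assms by (intro ext sum.mono_neutral_left) auto

lemma fa_subst_zero: "fa_subst g fa_zero = fa_zero"
  by (simp add: fa_subst_def fa_zero_def)

lemma fa_subst_mono: "fa_subst g (fa_mono w) = word_img g w"
  by (subst fa_subst_eq_sum[of "{w}"]) (auto simp: fa_mono_def split: if_splits)

lemma fa_subst_smul: "fs f \<Longrightarrow> fa_subst g (fa_smul c f) = fa_smul c (fa_subst g f)"
  by (subst (1 2) fa_subst_eq_sum[of "{w. f w \<noteq> 0}"])
    (auto simp: fs_def fa_smul_def sum_distrib_left mult.assoc)

lemma fa_subst_add:
  assumes "fs f" "fs f'"
  shows "fa_subst g (fa_add f f') = fa_add (fa_subst g f) (fa_subst g f')"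
proof -
  let ?S = "{w. f w \<noteq> 0} \<union> {w. f' w \<noteq> 0}"
  have S: "finite ?S" using assms by (simp add: fs_def)
  have "fa_subst g (fa_add f f') = (\<lambda>v. \<Sum>w\<in>?S. fa_add f f' w * word_img g w v)"
    "fa_subst g f = (\<lambda>v. \<Sum>w\<in>?S. f w * word_img g w v)"
    "fa_subst g f' = (\<lambda>v. \<Sum>w\<in>?S. f' w * word_img g w v)"
    by (rule fa_subst_eq_sum[OF S]; auto simp: fa_add_def)+
  then show ?thesis by (simp add: fa_add_def sum.distrib algebra_simps)
qed

lemma fa_sub_eq: "fa_sub f f' = fa_add f (fa_smul (- 1) f')"
  by (simp add: fa_sub_def fa_add_def fa_smul_def)

lemma fa_subst_sub:
  "fs f \<Longrightarrow> fs f' \<Longrightarrow> fa_subst g (fa_sub f f') = fa_sub (fa_subst g f) (fa_subst g f')"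
  by (simp add: fa_sub_eq fa_subst_add fa_subst_smul fs_intros)

lemma fa_subst_one: "fa_subst g fa_one = fa_one"
  using fa_subst_mono[of g "[]"] by (simp add: fa_mono_Nil)

lemma fa_subst_var: "fa_subst g (fa_var i) = g i"
  using fa_subst_mono[of g "[i]"] by (simp add: fa_mono_Cons fa_mono_Nil fa_mul_one)

lemma word_img_append: "word_img g (u @ v) = fa_mul (word_img g u) (word_img g v)"
  by (induction u) (simp_all add: fa_mul_one fa_mul_assoc)

text \<open>Linearity in both factors reduces the claim to two words, where it is
  \<open>word_img_append\<close>.\<close>

lemma fa_subst_mul:
  assumes "fs f" "fs f'"
  shows "fa_subst g (fa_mul f f') = fa_mul (fa_subst g f) (fa_subst g f')"
  using assms(1)
proof (induction f rule: fs_induct)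
  case zero
  then show ?case by (simp add: fa_mul_linear fa_subst_zero)
next
  case (add f c u)
  have "fa_subst g (fa_mul (fa_mono u) f') = fa_mul (word_img g u) (fa_subst g f')"
    using assms(2)
  proof (induction f' rule: fs_induct)
    case zero
    then show ?case by (simp add: fa_mul_linear fa_subst_zero)
  next
    case (add f' c v)
    then show ?case
      by (simp add: fa_mul_linear fa_subst_add fa_subst_smul fs_intros fs_mono fa_subst_mono
          word_img_append flip: fa_mono_append)
  qed
  with add assms(2) show ?case
    by (simp add: fa_mul_linear fa_subst_add fa_subst_smul fs_intros fs_mono fa_subst_mono)
qed

lemmas fa_subst_simps = fa_subst_zero fa_subst_one fa_subst_var fa_subst_add fa_subst_sub
  fa_subst_smul fa_subst_mul

lemma fs_word_img: "(\<And>i. fs (g i)) \<Longrightarrow> fs (word_img g w)"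
  by (induction w) (simp_all add: fs_intros)

lemma fs_subst:
  assumes "\<And>i. fs (g i)" "fs y"
  shows "fs (fa_subst g y)"
  using assms(2)
  by (induction rule: fs_induct)
    (simp_all add: fa_subst_simps fa_subst_mono fs_intros fs_mono fs_word_img assms(1))

lemma fa_subst_subst:
  assumes "\<And>i. fs (g i)" "fs y"
  shows "fa_subst g' (fa_subst g y) = fa_subst (\<lambda>i. fa_subst g' (g i)) y"
  using assms(2)
proof (induction rule: fs_induct)
  case (add f c w)
  have "fa_subst g' (word_img g w) = word_img (\<lambda>i. fa_subst g' (g i)) w"
    by (induction w) (simp_all add: fa_subst_simps assms(1) fs_word_img)
  with add show ?case
    by (simp add: fa_subst_simps fa_subst_mono fs_intros fs_mono fs_word_img fs_subst assms(1))
qed (simp add: fa_subst_zero)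

lemma fa_subst_id: "fs y \<Longrightarrow> fa_subst fa_var y = y" for y :: "'a::field fa"
proof (induction rule: fs_induct)
  case (add f c w)
  have "word_img fa_var w = (fa_mono w :: 'a fa)"
    by (induction w) (simp_all add: fa_mono_Nil fa_mono_Cons)
  with add show ?case by (simp add: fa_subst_simps fa_subst_mono fs_intros fs_mono)
qed (simp add: fa_subst_zero)

section \<open>Ideals under scalars and substitution\<close>

lemma fs_ideal: "a \<in> fa_ideal R \<Longrightarrow> fs a"
  by (induction rule: fa_ideal.induct) (simp_all add: fs_intros)

lemma fa_ideal_left: "a \<in> fa_ideal R \<Longrightarrow> fs x \<Longrightarrow> fa_mul x a \<in> fa_ideal R"
  using fa_ideal.mul[of a R x fa_one] by (simp add: fs_one fa_mul_one)

lemma fa_ideal_right: "a \<in> fa_ideal R \<Longrightarrow> fs x \<Longrightarrow> fa_mul a x \<in> fa_ideal R"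
  using fa_ideal.mul[of a R fa_one x] by (simp add: fs_one fa_mul_one)

lemma fa_ideal_smul: "a \<in> fa_ideal R \<Longrightarrow> fa_smul c a \<in> fa_ideal R"
  using fa_ideal_left[of a R "fa_smul c fa_one"] by (simp add: fs_intros fa_mul_linear fa_mul_one)

lemma fa_ideal_subst:
  assumes "\<And>r. r \<in> R \<Longrightarrow> fs r \<Longrightarrow> fa_subst g r \<in> fa_ideal R'" "\<And>i. fs (g i)"
    and "a \<in> fa_ideal R"
  shows "fa_subst g a \<in> fa_ideal R'"
  using assms(3)
  by induction (simp_all add: assms fa_subst_simps fs_intros fs_ideal fs_subst fa_ideal.intros)

text \<open>Taking the constant term is multiplicative, so it kills the ideal as soon as it kills
  the generators.\<close>

lemma fa_ideal_Nil:
  assumes "\<And>r. r \<in> R \<Longrightarrow> r [] = 0" "a \<in> fa_ideal R"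
  shows "a [] = 0"
  using assms(2) by induction (simp_all add: assms(1) fa_zero_def fa_add_def fa_mul_def)

subsection \<open>Quotient rings\<close>

text \<open>Only a partial equivalence: functions with infinite support are related to nothing and
  thus stay outside the quotient types.\<close>

definition fa_cong :: "'k::field fa set \<Rightarrow> 'k fa \<Rightarrow> 'k fa \<Rightarrow> bool" where
  "fa_cong R f g \<longleftrightarrow> fs f \<and> fs g \<and> fa_sub f g \<in> fa_ideal R"

lemma fa_cong_refl: "fs f \<Longrightarrow> fa_cong R f f"
  using fa_ideal.zero[of R] by (simp add: fa_cong_def fa_sub_def fa_zero_def)

lemma fa_cong_sym: "fa_cong R f g \<Longrightarrow> fa_cong R g f"
  using fa_ideal_smul[of "fa_sub f g" R "- 1"] by (simp add: fa_cong_def fa_sub_def fa_smul_def)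

lemma fa_cong_trans: "fa_cong R f g \<Longrightarrow> fa_cong R g h \<Longrightarrow> fa_cong R f h"
  using fa_ideal.add[of "fa_sub f g" R "fa_sub g h"] by (simp add: fa_cong_def fa_sub_def fa_add_def)

lemma part_equivp_fa_cong: "part_equivp (fa_cong R)"
  using fa_cong_refl[OF fs_zero] by (intro part_equivpI sympI transpI) (auto intro: fa_cong_sym fa_cong_trans)

lemma fa_cong_add: "fa_cong R f g \<Longrightarrow> fa_cong R f' g' \<Longrightarrow> fa_cong R (fa_add f f') (fa_add g g')"
  using fa_ideal.add[of "fa_sub f g" R "fa_sub f' g'"]
  by (simp add: fa_cong_def fs_add) (simp add: fa_sub_def fa_add_def algebra_simps)

lemma fa_cong_smul: "fa_cong R f g \<Longrightarrow> fa_cong R (fa_smul c f) (fa_smul c g)"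
  using fa_ideal_smul[of "fa_sub f g" R c]
  by (simp add: fa_cong_def fs_smul) (simp add: fa_sub_def fa_smul_def algebra_simps)

lemma fa_cong_sub: "fa_cong R f g \<Longrightarrow> fa_cong R f' g' \<Longrightarrow> fa_cong R (fa_sub f f') (fa_sub g g')"
  by (simp add: fa_sub_eq fa_cong_add fa_cong_smul)

lemma fa_cong_mul:
  assumes "fa_cong R f g" "fa_cong R f' g'"
  shows "fa_cong R (fa_mul f f') (fa_mul g g')"
proof (rule fa_cong_trans)
  show "fa_cong R (fa_mul f f') (fa_mul g f')"
    using assms fa_ideal_right[of "fa_sub f g" R f'] by (simp add: fa_cong_def fs_mul fa_mul_linear)
  show "fa_cong R (fa_mul g f') (fa_mul g g')"
    using assms fa_ideal_left[of "fa_sub f' g'" R g] by (simp add: fa_cong_def fs_mul fa_mul_linear)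
qed

lemma fa_cong_zero_iff: "fs f \<Longrightarrow> fa_cong R f fa_zero \<longleftrightarrow> f \<in> fa_ideal R"
  by (simp add: fa_cong_def fs_zero) (simp add: fa_sub_def fa_zero_def)

text \<open>A presentation of the ring \<open>'a\<close>: the map \<open>\<pi>\<close> induces an isomorphism of rings from the
  free algebra modulo \<open>fa_ideal R\<close> to \<open>'a\<close>.\<close>

locale presentation =
  fixes R :: "'k::field fa set" and \<pi> :: "'k fa \<Rightarrow> 'a::ring_1"
  assumes one: "\<pi> fa_one = 1"
    and add: "fs f \<Longrightarrow> fs g \<Longrightarrow> \<pi> (fa_add f g) = \<pi> f + \<pi> g"
    and mul: "fs f \<Longrightarrow> fs g \<Longrightarrow> \<pi> (fa_mul f g) = \<pi> f * \<pi> g"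
    and kernel: "fs f \<Longrightarrow> \<pi> f = 0 \<longleftrightarrow> f \<in> fa_ideal R"
    and surj: "\<exists>f. fs f \<and> \<pi> f = z"

text \<open>The class \<open>ring_1\<close> demands \<open>0 \<noteq> 1\<close>. All relators have
  constant term 0, also those in which \<open>hh 0 = fa_one\<close> occurs.\<close>

lemma nontrivial_osym: "\<not> fa_cong osym_rels fa_zero (fa_one :: 'k::field fa)"
proof
  assume "fa_cong osym_rels fa_zero (fa_one :: 'k fa)"
  then have "(fa_one :: 'k fa) \<in> fa_ideal osym_rels"
    by (metis fa_cong_sym fa_cong_zero_iff fs_one)
  moreover have "r [] = 0" if "r \<in> osym_rels" for r :: "'k fa"
    using that
    by (auto simp: osym_rels_def fa_comm_def fa_sub_def fa_add_def fa_smul_def fa_mul_def hh_def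
        fa_one_def fa_var_def)
  ultimately have "(fa_one :: 'k fa) [] = 0" by (metis fa_ideal_Nil)
  then show False by (simp add: fa_one_def)
qed

lemma nontrivial_pres: "\<not> fa_cong pres_rels fa_zero (fa_one :: 'k::field fa)"
proof
  assume "fa_cong pres_rels fa_zero (fa_one :: 'k fa)"
  then have "(fa_one :: 'k fa) \<in> fa_ideal pres_rels"
    by (metis fa_cong_sym fa_cong_zero_iff fs_one)
  moreover have "r [] = 0" if "r \<in> pres_rels" for r :: "'k fa"
    using that
    by (auto simp: pres_rels_def fa_comm_def fa_sub_def fa_add_def fa_smul_def fa_mul_def
        fa_one_def fa_var_def)
  ultimately have "(fa_one :: 'k fa) [] = 0" by (metis fa_ideal_Nil)
  then show False by (simp add: fa_one_def)
qed

lemma fa_ring_laws: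
  "fa_add (fa_add f g) h = fa_add f (fa_add g h)" "fa_add f g = fa_add g f"
  "fa_add fa_zero f = f" "fa_add (fa_smul (- 1) f) f = fa_zero"
  "fa_sub f g = fa_add f (fa_smul (- 1) g)"
  "fa_mul (fa_mul f g) h = fa_mul f (fa_mul g h)" "fa_mul fa_one f = f" "fa_mul f fa_one = f"
  "fa_mul (fa_add f g) h = fa_add (fa_mul f h) (fa_mul g h)"
  "fa_mul f (fa_add g h) = fa_add (fa_mul f g) (fa_mul f h)"
  by (simp_all add: fa_mul_assoc fa_mul_one fa_mul_linear)
    (simp_all add: fa_add_def fa_sub_def fa_smul_def fa_zero_def algebra_simps)

lemma fa_cong_eqI: "f = g \<Longrightarrow> fs f \<Longrightarrow> fa_cong R f g"
  by (simp add: fa_cong_refl)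

lemma presentation_quotient:
  fixes abs :: "'k::field fa \<Rightarrow> 'a::ring_1"
  assumes Q: "Quotient3 (fa_cong R) abs rep"
    and zero: "0 = abs fa_zero" and one: "1 = abs fa_one"
    and add: "\<And>f g. fa_cong R f f \<Longrightarrow> fa_cong R g g \<Longrightarrow> abs f + abs g = abs (fa_add f g)"
    and mul: "\<And>f g. fa_cong R f f \<Longrightarrow> fa_cong R g g \<Longrightarrow> abs f * abs g = abs (fa_mul f g)"
  shows "presentation R abs"
proof
  show "\<exists>f. fs f \<and> abs f = z" for z
    using Quotient3_rep_reflp[OF Q, of z] Quotient3_abs_rep[OF Q, of z]
    by (auto simp: fa_cong_def)
  show "abs f = 0 \<longleftrightarrow> f \<in> fa_ideal R" if "fs f" for f
    using Quotient3_rel[OF Q, of f fa_zero] that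
    by (simp add: zero fa_cong_refl fs_zero fa_cong_zero_iff)
qed (simp_all add: one add mul fa_cong_refl)

\<comment> \<open>The two quotients as rings\<close>
quotient_type (overloaded) 'k osym = "'k::field fa" / partial: "fa_cong osym_rels"
  by (rule part_equivp_fa_cong)

instantiation osym :: (field) ring_1
begin

lift_definition zero_osym :: "'a osym" is fa_zero by (rule fa_cong_refl[OF fs_zero])
lift_definition one_osym :: "'a osym" is fa_one by (rule fa_cong_refl[OF fs_one])
lift_definition plus_osym :: "'a osym \<Rightarrow> 'a osym \<Rightarrow> 'a osym" is fa_add by (rule fa_cong_add)
lift_definition minus_osym :: "'a osym \<Rightarrow> 'a osym \<Rightarrow> 'a osym" is fa_sub by (rule fa_cong_sub)
lift_definition uminus_osym :: "'a osym \<Rightarrow> 'a osym" is "fa_smul (- 1)" by (rule fa_cong_smul)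
lift_definition times_osym :: "'a osym \<Rightarrow> 'a osym \<Rightarrow> 'a osym" is fa_mul by (rule fa_cong_mul)

instance
proof
  fix x y z :: "'a osym"
  show "x + y + z = x + (y + z)" "x + y = y + x" "0 + x = x" "- x + x = 0" "x - y = x + - y"
    "x * y * z = x * (y * z)" "1 * x = x" "x * 1 = x" "(x + y) * z = x * z + y * z"
    "x * (y + z) = x * y + x * z"
    by (transfer, rule fa_cong_eqI, rule fa_ring_laws, simp add: fa_cong_def fs_intros)+
  show "(0 :: 'a osym) \<noteq> 1" by transfer (rule nontrivial_osym)
qed

end

lemma presentation_osym: "presentation osym_rels abs_osym"
  by (rule presentation_quotient[OF Quotient3_osym])
    (rule zero_osym.abs_eq one_osym.abs_eq plus_osym.abs_eq times_osym.abs_eq; assumption)+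

quotient_type (overloaded) 'k pres = "'k::field fa" / partial: "fa_cong pres_rels"
  by (rule part_equivp_fa_cong)

instantiation pres :: (field) ring_1
begin

lift_definition zero_pres :: "'a pres" is fa_zero by (rule fa_cong_refl[OF fs_zero])
lift_definition one_pres :: "'a pres" is fa_one by (rule fa_cong_refl[OF fs_one])
lift_definition plus_pres :: "'a pres \<Rightarrow> 'a pres \<Rightarrow> 'a pres" is fa_add by (rule fa_cong_add)
lift_definition minus_pres :: "'a pres \<Rightarrow> 'a pres \<Rightarrow> 'a pres" is fa_sub by (rule fa_cong_sub)
lift_definition uminus_pres :: "'a pres \<Rightarrow> 'a pres" is "fa_smul (- 1)" by (rule fa_cong_smul)
lift_definition times_pres :: "'a pres \<Rightarrow> 'a pres \<Rightarrow> 'a pres" is fa_mul by (rule fa_cong_mul)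

instance
proof
  fix x y z :: "'a pres"
  show "x + y + z = x + (y + z)" "x + y = y + x" "0 + x = x" "- x + x = 0" "x - y = x + - y"
    "x * y * z = x * (y * z)" "1 * x = x" "x * 1 = x" "(x + y) * z = x * z + y * z"
    "x * (y + z) = x * y + x * z"
    by (transfer, rule fa_cong_eqI, rule fa_ring_laws, simp add: fa_cong_def fs_intros)+
  show "(0 :: 'a pres) \<noteq> 1" by transfer (rule nontrivial_pres)
qed

end

lemma presentation_pres: "presentation pres_rels abs_pres"
  by (rule presentation_quotient[OF Quotient3_pres])
    (rule zero_pres.abs_eq one_pres.abs_eq plus_pres.abs_eq times_pres.abs_eq; assumption)+

subsection \<open>Homomorphisms between presented rings\<close>

context presentation
begin

lemma zero: "\<pi> fa_zero = 0"
  by (simp add: kernel fs_zero fa_ideal.zero)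

lemma uminus: "fs f \<Longrightarrow> \<pi> (fa_smul (- 1) f) = - \<pi> f"
  using add[of "fa_smul (- 1) f" f] by (simp add: fs_smul fa_ring_laws(4) zero eq_neg_iff_add_eq_0)

lemma sub: "fs f \<Longrightarrow> fs g \<Longrightarrow> \<pi> (fa_sub f g) = \<pi> f - \<pi> g"
  by (simp add: fa_sub_eq add uminus fs_smul)

lemma comm: "fs f \<Longrightarrow> fs g \<Longrightarrow> \<pi> (fa_comm f g) = \<pi> f * \<pi> g - \<pi> g * \<pi> f"
  by (simp add: fa_comm_def sub mul fs_mul)

lemma sign: "fs f \<Longrightarrow> \<pi> (fa_smul ((- 1) ^ n) f) = (- 1) ^ n * \<pi> f"
  by (cases "even n") (simp_all add: uminus, simp add: fa_smul_def)

lemma signed_sum: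
  assumes "finite S" "\<And>s. s \<in> S \<Longrightarrow> fs (F s)"
  shows "\<pi> (\<lambda>w. \<Sum>s\<in>S. (- 1) ^ s * F s w) = (\<Sum>s\<in>S. (- 1) ^ s * \<pi> (F s))"
  using assms
proof (induction S rule: finite_induct)
  case empty
  then show ?case using zero by (simp add: fa_zero_def)
next
  case (insert s S)
  then show ?case
    unfolding fa_sum_insert[OF insert.hyps] by (simp add: add sign fs_smul fs_sum)
qed

lemma eq_iff: "fs f \<Longrightarrow> fs g \<Longrightarrow> \<pi> f = \<pi> g \<longleftrightarrow> fa_sub f g \<in> fa_ideal R"
  by (simp add: sub fs_sub flip: kernel)

lemma relation: "r \<in> R \<Longrightarrow> fs r \<Longrightarrow> \<pi> r = 0"
  by (simp add: kernel fa_ideal.gen)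

lemma half:
  assumes "(2 :: 'k) \<noteq> 0" "fs f"
  shows "\<pi> (fa_smul (inverse 2) f) + \<pi> (fa_smul (inverse 2) f) = \<pi> f"
proof -
  have "fa_add (fa_smul (inverse 2) f) (fa_smul (inverse 2) f) = f"
    using assms(1) by (simp add: fa_add_def fa_smul_def field_simps)
  then show ?thesis using assms(2) by (simp add: fs_smul flip: add)
qed

text \<open>The type \<open>'a\<close> is only a ring, so the division by 2 takes place on a
  representative in the free algebra.\<close>

lemma double_eq_0D:
  fixes z :: 'a
  assumes "(2 :: 'k) \<noteq> 0" "z + z = 0"
  shows "z = 0"
proof -
  obtain f where f: "fs f" "z = \<pi> f" using surj by metis
  with assms(2) have "fa_add f f \<in> fa_ideal R" by (simp add: fs_add flip: kernel add)
  then have "fa_smul (inverse 2) (fa_add f f) \<in> fa_ideal R" by (rule fa_ideal_smul)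
  moreover have "fa_smul (inverse 2) (fa_add f f) = f"
    using assms(1) by (simp add: fa_add_def fa_smul_def field_simps)
  ultimately show ?thesis using f by (simp add: kernel)
qed

text \<open>Homomorphisms that agree on letters agree on words and hence everywhere. This later
  identifies composed substitutions with the identity modulo the relations.\<close>

lemma subst_cong:
  assumes "\<And>i. fs (g i)" "\<And>i. fs (g' i)" "\<And>i. \<pi> (g i) = \<pi> (g' i)" "fs y"
  shows "\<pi> (fa_subst g y) = \<pi> (fa_subst g' y)"
  using assms(4)
proof (induction rule: fs_induct)
  case (add f c w)
  have "\<pi> (word_img g w) = \<pi> (word_img g' w)"
    by (induction w) (simp_all add: mul assms fs_word_img)
  then have "\<pi> (fa_smul c (word_img g w)) = \<pi> (fa_smul c (word_img g' w))"
    using fa_cong_smul[of R "word_img g w" "word_img g' w" c]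
    by (simp add: eq_iff fa_cong_def fs_intros fs_word_img assms)
  with add show ?case
    by (simp add: fa_subst_simps fa_subst_mono fs_intros fs_mono fs_word_img fs_subst assms
        presentation.add[OF presentation_axioms])
qed (simp add: fa_subst_zero)

end

definition unital_ring_hom :: "('a::ring_1 \<Rightarrow> 'b::ring_1) \<Rightarrow> bool" where
  "unital_ring_hom \<phi> \<longleftrightarrow> \<phi> 1 = 1 \<and> (\<forall>x y. \<phi> (x + y) = \<phi> x + \<phi> y) \<and> (\<forall>x y. \<phi> (x * y) = \<phi> x * \<phi> y)"

lemma inverse_seq_hom:
  assumes \<phi>: "unital_ring_hom \<phi>" and eh: "inverse_seq e h"
  shows "inverse_seq (\<lambda>n. \<phi> (e n)) (\<lambda>n. \<phi> (h n))"
proof -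
  have one: "\<phi> 1 = 1" and add: "\<And>x y. \<phi> (x + y) = \<phi> x + \<phi> y"
    and mul: "\<And>x y. \<phi> (x * y) = \<phi> x * \<phi> y"
    using \<phi> by (auto simp: unital_ring_hom_def)
  have zero: "\<phi> 0 = 0" using add[of 0 0] by simp
  have uminus: "\<phi> (- x) = - \<phi> x" for x
    using add[of "- x" x] zero by (simp add: eq_neg_iff_add_eq_0)
  have sign: "\<phi> ((- 1) ^ n) = (- 1) ^ n" for n
    by (cases "even n") (simp_all add: uminus one)
  have sum: "\<phi> (\<Sum>s\<in>S. F s) = (\<Sum>s\<in>S. \<phi> (F s))" if "finite S" for S and F :: "nat \<Rightarrow> 'a"
    using that by (induction S rule: finite_induct) (simp_all add: zero add)
  show ?thesis
    unfolding inverse_seq_def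
  proof
    fix r
    have "\<phi> (\<Sum>s\<le>r. (- 1) ^ s * e s * h (r - s)) = (if r = 0 then 1 else 0)"
      using eh by (simp add: inverse_seq_def one zero)
    then show "(\<Sum>s\<le>r. (- 1) ^ s * \<phi> (e s) * \<phi> (h (r - s))) = (if r = 0 then 1 else 0)"
      by (simp only: sum[OF finite_atMost] sign mul)
  qed
qed

text \<open>The universal property of a presentation: substitution maps the ideal of
  \<open>R\<close> into that of \<open>R'\<close>, so the value does not depend on the
  representative chosen.\<close>

lemma presentation_hom:
  assumes "presentation R \<pi>" "presentation R' \<pi>'" and g: "\<And>i. fs (g i)"
    and rels: "\<And>r. r \<in> R \<Longrightarrow> fs r \<Longrightarrow> \<pi>' (fa_subst g r) = 0"
  shows "\<exists>\<phi>. unital_ring_hom \<phi> \<and> (\<forall>f. fs f \<longrightarrow> \<phi> (\<pi> f) = \<pi>' (fa_subst g f))"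
proof -
  interpret P: presentation R \<pi> by fact
  interpret P': presentation R' \<pi>' by fact
  define rep where "rep z = (SOME f. fs f \<and> \<pi> f = z)" for z
  have rep: "fs (rep z)" "\<pi> (rep z) = z" for z
    using someI_ex[OF P.surj[of z]] by (simp_all add: rep_def)
  define \<phi> where "\<phi> z = \<pi>' (fa_subst g (rep z))" for z
  have \<phi>: "\<phi> (\<pi> f) = \<pi>' (fa_subst g f)" if "fs f" for f
  proof -
    have "fa_sub (rep (\<pi> f)) f \<in> fa_ideal R"
      using rep that by (simp flip: P.eq_iff)
    then have "fa_subst g (fa_sub (rep (\<pi> f)) f) \<in> fa_ideal R'"
      by (rule fa_ideal_subst[of R g R', rotated 2]) (simp_all add: rels g fs_subst flip: P'.kernel)
    then show ?thesis
      unfolding \<phi>_def using rep that by (simp add: fa_subst_sub P'.eq_iff fs_subst g)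
  qed
  have "unital_ring_hom \<phi>"
    unfolding unital_ring_hom_def
  proof (intro conjI allI)
    show "\<phi> 1 = 1" using \<phi>[OF fs_one] by (simp add: P.one P'.one fa_subst_one)
    fix x y
    show "\<phi> (x + y) = \<phi> x + \<phi> y"
      using \<phi>[of "fa_add (rep x) (rep y)"] \<phi>[of "rep x"] \<phi>[of "rep y"]
      by (simp add: rep P.add P'.add fa_subst_add fs_intros fs_subst g)
    show "\<phi> (x * y) = \<phi> x * \<phi> y"
      using \<phi>[of "fa_mul (rep x) (rep y)"] \<phi>[of "rep x"] \<phi>[of "rep y"]
      by (simp add: rep P.mul P'.mul fa_subst_mul fs_intros fs_subst g)
  qed
  then show ?thesis using \<phi> by blast
qed

subsection \<open>The two presentations\<close>

lemma osym_seq_hh: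
  assumes "presentation osym_rels \<pi>"
  shows "osym_seq (\<lambda>n. \<pi> (hh n))"
proof -
  interpret presentation osym_rels \<pi> by fact
  have h0: "\<pi> (hh 0) = 1" by (simp add: hh_def one)
  have comm_rel: "\<pi> (hh i) * \<pi> (hh j) = \<pi> (hh j) * \<pi> (hh i)" if "i mod 2 = j mod 2" for i j
  \<comment> \<open>The relators demand \<open>1 \<le> s\<close>; for \<open>j = 0\<close> the claim
    is commutation with 1.\<close>
  proof (cases "j = 0")
    case False
    then have "\<pi> (fa_comm (hh i) (hh j)) = 0"
      using that by (intro relation fs_intros) (auto simp: osym_rels_def)
    then show ?thesis by (simp add: comm fs_hh)
  qed (simp add: h0)
  have mixed: "\<pi> (hh i) * \<pi> (hh (Suc j)) + (- 1) ^ i * (\<pi> (hh (Suc j)) * \<pi> (hh i))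
      = (- 1) ^ i * (\<pi> (hh (Suc i)) * \<pi> (hh j)) + \<pi> (hh j) * \<pi> (hh (Suc i))"
    if "i mod 2 = j mod 2" for i j
  proof -
    let ?r = "fa_sub (fa_add (fa_mul (hh i) (hh (Suc j))) (fa_smul ((-1)^i) (fa_mul (hh (Suc j)) (hh i))))
             (fa_add (fa_smul ((-1)^i) (fa_mul (hh (i+1)) (hh (Suc j-1)))) (fa_mul (hh (Suc j-1)) (hh (i+1))))"
    have "i mod 2 \<noteq> Suc j mod 2" using that by presburger
    then have "?r \<in> osym_rels" unfolding osym_rels_def by fastforce
    then have "\<pi> ?r = 0" by (intro relation fs_intros)
    then show ?thesis by (simp add: sub add mul sign fs_intros)
  qed
  show ?thesis
    unfolding osym_seq_def
  proof (intro conjI allI impI h0)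
    fix i j :: nat
    show "\<pi> (hh i) * \<pi> (hh j) = \<pi> (hh j) * \<pi> (hh i)" if "even i" "even j"
      using that by (intro comm_rel) presburger
    show "\<pi> (hh i) * \<pi> (hh j) = \<pi> (hh j) * \<pi> (hh i)" if "odd i" "odd j"
      using that by (intro comm_rel) presburger
    show "\<pi> (hh i) * \<pi> (hh (Suc j)) + \<pi> (hh (Suc j)) * \<pi> (hh i)
        = \<pi> (hh j) * \<pi> (hh (Suc i)) + \<pi> (hh (Suc i)) * \<pi> (hh j)" if "even i" "even j"
      using mixed[of i j] that by (simp add: even_iff_mod_2_eq_zero add.commute)
    show "\<pi> (hh i) * \<pi> (hh (Suc j)) - \<pi> (hh (Suc j)) * \<pi> (hh i)
        = \<pi> (hh j) * \<pi> (hh (Suc i)) - \<pi> (hh (Suc i)) * \<pi> (hh j)" if "odd i" "odd j"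
      using mixed[of i j] that by (simp add: odd_iff_mod_2_eq_one)
  qed
qed

text \<open>This makes homomorphisms out of $OSym$ well defined: the target only has to contain a
  sequence satisfying \<open>osym_seq\<close>.\<close>

lemma osym_rels_vanish:
  fixes \<pi> :: "'k::field fa \<Rightarrow> 'a::ring_1"
  assumes "presentation R \<pi>" and g: "\<And>i. fs (g i)"
    and h: "osym_seq (\<lambda>n. \<pi> (fa_subst g (hh n)))" and r: "r \<in> osym_rels"
  shows "\<pi> (fa_subst g r) = 0"
proof -
  interpret presentation R \<pi> by fact
  define h where "h n = \<pi> (fa_subst g (hh n))" for n
  note h = osym_seqD[OF h[folded h_def]]
  from r consider (1) i j where "r = fa_comm (hh i) (hh j)" "i mod 2 = j mod 2"
    | (2) i j where "1 \<le> j" "i mod 2 \<noteq> j mod 2"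
      "r = fa_sub (fa_add (fa_mul (hh i) (hh j)) (fa_smul ((-1)^i) (fa_mul (hh j) (hh i))))
         (fa_add (fa_smul ((-1)^i) (fa_mul (hh (i+1)) (hh (j-1)))) (fa_mul (hh (j-1)) (hh (i+1))))"
    unfolding osym_rels_def by blast
  then show ?thesis
  proof cases
    case 1
    have "even i \<and> even j \<or> odd i \<and> odd j" using 1(2) by presburger
    then have "h i * h j = h j * h i" using h(2)[of i j] h(3)[of i j] by blast
    then show ?thesis
      by (simp add: 1 fa_comm_def fa_subst_simps fs_intros fs_subst g sub mul flip: h_def)
  next
    case 2
    then obtain l where l: "j = Suc l" by (cases j) auto
    have "even i \<and> even l \<or> odd i \<and> odd l" using 2(2) unfolding l by presburger
    then have "h i * h j + (- 1) ^ i * (h j * h i) = (- 1) ^ i * (h (i + 1) * h l) + h l * h (i + 1)"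
    proof (elim disjE conjE)
      assume "even i" "even l"
      moreover from this have "h i * h (Suc l) + h (Suc l) * h i = h l * h (Suc i) + h (Suc i) * h l"
        by (rule h(4))
      ultimately show ?thesis by (simp add: l add.commute)
    next
      assume "odd i" "odd l"
      moreover from this have "h i * h (Suc l) - h (Suc l) * h i = h l * h (Suc i) - h (Suc i) * h l"
        by (rule h(5))
      ultimately show ?thesis by (simp add: l)
    qed
    then show ?thesis
      by (simp add: 2(3) l fa_subst_simps fs_intros fs_subst g sub add mul sign flip: h_def)
  qed
qed

text \<open>The recursion for \<open>ee\<close> is this identity solved for the summand
  \<open>s = r\<close>, whose second factor is \<open>h_0 = 1\<close>.\<close>

lemma inverse_seq_ee_hh:
  fixes \<pi> :: "'k::field fa \<Rightarrow> 'a::ring_1"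
  assumes "presentation R \<pi>"
  shows "inverse_seq (\<lambda>n. \<pi> (ee n)) (\<lambda>n. \<pi> (hh n))"
  unfolding inverse_seq_def
proof
  fix r
  interpret presentation R \<pi> by fact
  let ?S = "\<Sum>s<r. (- 1) ^ s * \<pi> (ee s) * \<pi> (hh (r - s))"
  have h0: "\<pi> (hh 0) = 1" by (simp add: hh_def one)
  show "(\<Sum>s\<le>r. (- 1) ^ s * \<pi> (ee s) * \<pi> (hh (r - s))) = (if r = 0 then 1 else 0)"
  proof (cases "r = 0")
    case True
    then show ?thesis by (simp add: h0 one ee_0)
  next
    case False
    let ?f = "\<lambda>w. \<Sum>s<r. (- 1) ^ s * fa_mul (ee s) (hh (r - s) :: 'k fa) w"
    have "ee r = fa_smul (- 1) (fa_smul ((- 1) ^ r) ?f)"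
      using False by (simp add: ee.simps[of r] fa_smul_def)
    moreover have "fs ?f" by (intro fs_sum fs_intros fs_ee) simp
    moreover have "\<pi> ?f = ?S"
      by (subst signed_sum) (simp_all add: fs_intros fs_ee mul mult.assoc)
    ultimately have "\<pi> (ee r) = - ((- 1) ^ r * ?S)"
      by (simp add: uminus sign fs_smul)
    then have "(- 1) ^ r * \<pi> (ee r) = - ?S"
      by (simp flip: mult.assoc power_add)
    then show ?thesis using False by (simp add: h0 flip: lessThan_Suc_atMost)
  qed
qed

lemma pres_rels_vanish:
  assumes "presentation R \<pi>" and two: "(2 :: 'k::field) \<noteq> 0"
    and e: "osym_seq (\<lambda>n. \<pi> (ee n :: 'k fa))" and r: "r \<in> pres_rels"
  shows "\<pi> (fa_subst pres_img r) = 0"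
proof -
  interpret presentation R \<pi> by fact
  note red = osym_seq_reduced[OF e]
  have fs_img: "fs (pres_img i :: 'k fa)" for i by (simp add: pres_img_def fs_ee)
  from r consider (1) i j where "r = fa_comm (fa_var i) (fa_var j)" "1 \<le> i" "1 \<le> j"
    | (2) i where "r = fa_comm (fa_mul (fa_var 0) (fa_var 0)) (fa_var i)" "1 \<le> i"
    | (3) i where "1 \<le> i" "r = fa_sub (fa_comm (fa_var 0) (fa_var (i+1)))
       (fa_comm (fa_smul (inverse 2) (fa_add (fa_mul (fa_var 0) (fa_var i)) (fa_mul (fa_var i) (fa_var 0))))
                (fa_var 1))"
    unfolding pres_rels_def by blast
  then show ?thesis
  proof cases
    case 1
    then show ?thesis
      using red(1)[of "2 * i" "2 * j"]
      by (simp add: fa_comm_def fa_subst_simps fs_intros fs_img sub mul)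
        (simp add: pres_img_def)
  next
    case 2
    then show ?thesis
      using red(3)[of "2 * i"]
      by (simp add: fa_comm_def fa_subst_simps fs_intros fs_img sub mul)
        (simp add: pres_img_def)
  next
    case 3
    \<comment> \<open>Half of \<open>?s\<close> and \<open>e_(2i+1)\<close> have the same double, so
      they agree in the quotient and the relator becomes \<open>red(4)\<close>.\<close>
    let ?s = "fa_add (fa_mul (ee 1) (ee (2 * i))) (fa_mul (ee (2 * i)) (ee 1)) :: 'k fa"
    have "\<pi> (fa_smul (inverse 2) ?s) + \<pi> (fa_smul (inverse 2) ?s) = \<pi> (ee (Suc (2 * i))) + \<pi> (ee (Suc (2 * i)))"
      using red(2)[of "2 * i"] half[OF two, of ?s] by (simp add: fs_intros fs_ee add mul)
    then have "\<pi> (fa_smul (inverse 2) ?s) = \<pi> (ee (Suc (2 * i)))"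
      using double_eq_0D[OF two, of "\<pi> (fa_smul (inverse 2) ?s) - \<pi> (ee (Suc (2 * i)))"]
      by (simp add: algebra_simps)
    then show ?thesis
      using red(4)[of "2 * i"] 3
      by (simp add: fa_comm_def fa_subst_simps fs_intros fs_img sub mul)
        (simp add: pres_img_def)
  qed
qed

text \<open>\<open>pres_e n\<close> represents \<open>e\<^sub>n\<close> in the presented algebra.\<close>

definition pres_even :: "nat \<Rightarrow> 'k::field fa" where
  "pres_even i = (if i = 0 then fa_one else fa_var i)"

definition pres_e :: "nat \<Rightarrow> 'k::field fa" where
  "pres_e n = (if even n then pres_even (n div 2) else
     fa_smul (inverse 2) (fa_add (fa_mul (fa_var 0) (pres_even (n div 2))) (fa_mul (pres_even (n div 2)) (fa_var 0))))"

lemma pres_e_even: "pres_e (2 * i) = pres_even i"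
  by (simp add: pres_e_def)

lemma pres_relsI:
  "1 \<le> i \<Longrightarrow> 1 \<le> j \<Longrightarrow> fa_comm (fa_var i) (fa_var j) \<in> pres_rels"
  "1 \<le> i \<Longrightarrow> fa_comm (fa_mul (fa_var 0) (fa_var 0)) (fa_var i) \<in> pres_rels"
  "1 \<le> i \<Longrightarrow> fa_sub (fa_comm (fa_var 0) (fa_var (i+1)))
       (fa_comm (fa_smul (inverse 2) (fa_add (fa_mul (fa_var 0) (fa_var i)) (fa_mul (fa_var i) (fa_var 0))))
                (fa_var 1)) \<in> pres_rels"
  unfolding pres_rels_def by blast+

lemma osym_seq_pres_e:
  fixes \<pi> :: "'k::field fa \<Rightarrow> 'a::ring_1"
  assumes "presentation pres_rels \<pi>" and two: "(2 :: 'k) \<noteq> 0"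
  shows "\<pi> (pres_e 1) = \<pi> (fa_var 0)" and "osym_seq (\<lambda>n. \<pi> (pres_e n))"
proof -
  interpret presentation pres_rels \<pi> by fact
  have fs_even: "fs (pres_even i :: 'k fa)" for i by (simp add: pres_even_def fs_intros)
  have odd: "\<pi> (pres_e (Suc (2 * i))) + \<pi> (pres_e (Suc (2 * i)))
      = \<pi> (fa_var 0) * \<pi> (pres_e (2 * i)) + \<pi> (pres_e (2 * i)) * \<pi> (fa_var 0)" for i
    using half[OF two, of "fa_add (fa_mul (fa_var 0) (pres_even i)) (fa_mul (pres_even i) (fa_var 0))"]
    by (simp add: pres_e_def fs_even fs_intros add mul)
  have e0: "\<pi> (pres_e 0) = 1" by (simp add: pres_e_def pres_even_def one)
  \<comment> \<open>By construction \<open>e_1\<close> is half of o * 1 + 1 * o.\<close>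
  show e1: "\<pi> (pres_e 1) = \<pi> (fa_var 0)"
    using odd[of 0] double_eq_0D[OF two, of "\<pi> (pres_e 1) - \<pi> (fa_var 0)"] e0
    by (simp add: algebra_simps)
  show "osym_seq (\<lambda>n. \<pi> (pres_e n))"
  proof (rule osym_seqI_reduced)
    show "z + z = 0 \<Longrightarrow> z = 0" for z :: 'a by (rule double_eq_0D[OF two])
    show "\<pi> (pres_e 0) = 1" by (rule e0)
    show "\<pi> (pres_e m) * \<pi> (pres_e n) = \<pi> (pres_e n) * \<pi> (pres_e m)"
      if m: "even m" and n: "even n" for m n
    proof -
      obtain i where i: "m = 2 * i" using m by (rule evenE)
      obtain j where j: "n = 2 * j" using n by (rule evenE)
      \<comment> \<open>Index 0 means \<open>e_0 = 1\<close>, whereas letter 0 is o; the relators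
        concern positive indices.\<close>
      show ?thesis
      proof (cases "i = 0 \<or> j = 0")
        case False
        then have "\<pi> (fa_comm (fa_var i) (fa_var j)) = 0"
          by (intro relation fs_intros pres_relsI) simp_all
        then show ?thesis using False by (simp add: i j pres_e_even pres_even_def comm fs_var)
      qed (auto simp: i j e0)
    qed
    fix n :: nat
    assume "even n"
    then obtain i where n: "n = 2 * i" by (rule evenE)
    show "\<pi> (pres_e (Suc n)) + \<pi> (pres_e (Suc n))
        = \<pi> (pres_e 1) * \<pi> (pres_e n) + \<pi> (pres_e n) * \<pi> (pres_e 1)"
      unfolding e1 n by (rule odd)
    show "\<pi> (pres_e 1) * \<pi> (pres_e 1) * \<pi> (pres_e n) = \<pi> (pres_e n) * (\<pi> (pres_e 1) * \<pi> (pres_e 1))"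
    proof (cases "i = 0")
      case False
      then have "\<pi> (fa_comm (fa_mul (fa_var 0) (fa_var 0)) (fa_var i)) = 0"
        by (intro relation fs_intros pres_relsI) simp_all
      then show ?thesis
        using False unfolding e1 n by (simp add: pres_e_even pres_even_def comm mul fs_intros)
    qed (simp add: n e0)
    show "\<pi> (pres_e 1) * \<pi> (pres_e (Suc (Suc n))) - \<pi> (pres_e (Suc (Suc n))) * \<pi> (pres_e 1)
        = \<pi> (pres_e (Suc n)) * \<pi> (pres_e 2) - \<pi> (pres_e 2) * \<pi> (pres_e (Suc n))"
    \<comment> \<open>For \<open>i = 0\<close> both sides are the commutator of \<open>e_1\<close>
      and \<open>e_2\<close>.\<close>
    proof (cases "i = 0")
      case False
      let ?s = "fa_smul (inverse 2) (fa_add (fa_mul (fa_var 0) (fa_var i)) (fa_mul (fa_var i) (fa_var 0))) :: 'k fa"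
      have s: "pres_e (Suc n) = ?s" using False by (simp add: n pres_e_def pres_even_def)
      have e2: "pres_e (Suc (Suc n)) = fa_var (i + 1)" "pres_e 2 = fa_var 1"
        by (simp_all add: n pres_e_def pres_even_def)
      have "\<pi> (fa_sub (fa_comm (fa_var 0) (fa_var (i + 1))) (fa_comm ?s (fa_var 1))) = 0"
        using False by (intro relation fs_intros pres_relsI) simp_all
      then show ?thesis unfolding e1 e2 s by (simp add: sub comm fs_intros)
    qed (simp add: n numeral_2_eq_2)
  qed
qed

section \<open>Mutually inverse homomorphisms between $OSym$ and the presented algebra\<close>

theorem mainTheorem5:
  fixes dummy :: "'k::field"
  assumes alg_closed: "\<forall>p :: 'k poly. 1 \<le> degree p \<longrightarrow> (\<exists>x. poly p x = 0)"
    and char_not_2: "(2::'k) \<noteq> 0"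
  shows "(\<forall>x :: 'k fa. fs x \<longrightarrow>
            (\<exists>y. fs y \<and> fa_sub x (fa_subst pres_img y) \<in> osym_ideal))
       \<and> (\<forall>y :: 'k fa. fs y \<longrightarrow>
            (fa_subst pres_img y \<in> osym_ideal \<longleftrightarrow> y \<in> fa_ideal pres_rels))"
proof -
  interpret O: presentation osym_rels "abs_osym :: 'k fa \<Rightarrow> 'k osym" by (rule presentation_osym)
  interpret P: presentation pres_rels "abs_pres :: 'k fa \<Rightarrow> 'k pres" by (rule presentation_pres)
  define h e where "h n = abs_osym (hh n :: 'k fa)" and "e n = abs_osym (ee n :: 'k fa)" for n
  define E where "E n = abs_pres (pres_e n :: 'k fa)" for n
  have fs_img: "fs (pres_img i :: 'k fa)" for i by (simp add: pres_img_def fs_ee)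
  have h: "osym_seq h" unfolding h_def by (rule osym_seq_hh[OF presentation_osym])
  have eh: "inverse_seq e h" unfolding e_def h_def by (rule inverse_seq_ee_hh[OF presentation_osym])
  have e: "osym_seq e" by (rule osym_seq_inverse_seq[OF h eh])
  have h0: "h 0 = 1" using h by (simp add: osym_seq_def)
  obtain \<phi> where \<phi>: "unital_ring_hom \<phi>"
    "\<And>f :: 'k fa. fs f \<Longrightarrow> \<phi> (abs_pres f) = abs_osym (fa_subst pres_img f)"
    using presentation_hom[OF presentation_pres presentation_osym fs_img
        pres_rels_vanish[OF presentation_osym char_not_2 e[unfolded e_def]]] by blast
  have E: "osym_seq E" and E1: "E 1 = abs_pres (fa_var 0)"
    unfolding E_def using osym_seq_pres_e[OF presentation_pres char_not_2] by simp_all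
  obtain H where H: "osym_seq H" and EH: "inverse_seq E H"
    using osym_seq_ex_inverse_seq[OF E] .
  have H0: "H 0 = 1" using H by (simp add: osym_seq_def)
  \<comment> \<open>Letter \<open>i\<close> of $OSym$ stands for h_(i+1), hence
    \<open>Suc i\<close>; \<open>k\<close> lifts the constructed sequence \<open>H\<close> to the
    free algebra.\<close>
  define k where "k i = (SOME f :: 'k fa. fs f \<and> abs_pres f = H (Suc i))" for i
  have k: "fs (k i)" "abs_pres (k i) = H (Suc i)" for i
    using someI_ex[OF P.surj[of "H (Suc i)"]] by (simp_all add: k_def)
  have hh_k: "abs_pres (fa_subst k (hh n)) = H n" for n
    by (cases n) (simp_all add: hh_def fa_subst_one fa_subst_var P.one H0 k)
  obtain \<psi> where \<psi>: "unital_ring_hom \<psi>"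
    "\<And>f :: 'k fa. fs f \<Longrightarrow> \<psi> (abs_osym f) = abs_pres (fa_subst k f)"
    using presentation_hom[of osym_rels abs_osym pres_rels abs_pres k, OF presentation_osym presentation_pres k(1)
        osym_rels_vanish[OF presentation_pres k(1)]] H unfolding hh_k by blast
  have \<psi>h: "\<psi> (h n) = H n" for n by (simp add: h_def \<psi>(2) fs_hh hh_k)
  \<comment> \<open>Both sequences are linked to \<open>H\<close> by the recursion, whose solution
    is unique.\<close>
  have "(\<lambda>n. \<psi> (e n)) = E"
    using inverse_seq_hom[OF \<psi>(1) eh] EH H0 unfolding \<psi>h by (rule inverse_seq_unique_left)
  then have \<psi>e: "\<psi> (e n) = E n" for n by metis
  have \<phi>E1: "\<phi> (E 1) = e 1"
    unfolding E1 by (simp add: \<phi>(2) fs_var fa_subst_var pres_img_def e_def)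
  have \<phi>E_even: "\<phi> (E (2 * i)) = e (2 * i)" for i
    by (simp add: E_def e_def pres_e_even pres_even_def \<phi>(2) fs_intros fa_subst_simps pres_img_def ee_0)
  have \<phi>E: "\<phi> (E n) = e n" for n
  proof (cases "even n")
    case True
    then show ?thesis using \<phi>E_even[of "n div 2"] by simp
  next
    case False
    then obtain i where "n = 2 * i + 1" by (rule oddE)
    then have n: "n = Suc (2 * i)" by simp
    \<comment> \<open>Twice an odd element is an anticommutator of elements whose images are already
      known.\<close>
    have "\<phi> (E n) + \<phi> (E n) = \<phi> (E n + E n)"
      using \<phi>(1) by (simp add: unital_ring_hom_def)
    also have "E n + E n = E 1 * E (2 * i) + E (2 * i) * E 1"
      unfolding n by (rule osym_seq_reduced[OF E]) simp
    also have "\<phi> \<dots> = e 1 * e (2 * i) + e (2 * i) * e 1"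
      using \<phi>(1) \<phi>E1 \<phi>E_even by (simp add: unital_ring_hom_def)
    also have "\<dots> = e n + e n"
      unfolding n by (rule osym_seq_reduced(2)[OF e, symmetric]) simp
    finally show ?thesis
      using O.double_eq_0D[OF char_not_2, of "\<phi> (E n) - e n"] by (simp add: algebra_simps)
  qed
  \<comment> \<open>Conversely, the recursion determines the \<open>h_n\<close> from the
    \<open>e_n\<close>.\<close>
  have "h = (\<lambda>n. \<phi> (H n))"
    using inverse_seq_hom[OF \<phi>(1) EH] eh h0 unfolding \<phi>E by (metis inverse_seq_unique_right)
  then have \<phi>H: "\<phi> (H n) = h n" for n by metis
  show ?thesis
  proof (intro conjI allI impI)
    fix x :: "'k fa"
    assume x: "fs x"
    have "abs_osym (fa_subst pres_img (k i)) = abs_osym (fa_var i)" for i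
      using \<phi>(2)[OF k(1)[of i]] \<phi>H[of "Suc i"] by (simp add: k h_def hh_def)
    \<comment> \<open>The composite of \<open>\<psi>\<close> followed by \<open>\<phi>\<close> fixes
      the generators, so \<open>fa_subst k x\<close> is a preimage of \<open>x\<close> modulo the
      ideal.\<close>
    then have "abs_osym (fa_subst pres_img (fa_subst k x)) = abs_osym x"
      using O.subst_cong[of "\<lambda>i. fa_subst pres_img (k i)" fa_var x] x
      by (simp add: fa_subst_subst k fs_subst fs_img fs_var fa_subst_id)
    then show "\<exists>y. fs y \<and> fa_sub x (fa_subst pres_img y) \<in> osym_ideal"
      using x by (intro exI[of _ "fa_subst k x"])
        (simp add: fs_subst k fs_img osym_ideal_def flip: O.eq_iff)
  next
    fix y :: "'k fa"
    assume y: "fs y"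
    have "abs_pres (fa_subst k (pres_img i)) = abs_pres (fa_var i)" for i
      using \<psi>(2)[OF fs_img[of i]] \<psi>e[of 1] \<psi>e[of "2 * i"] E1
      by (cases "i = 0") (simp_all add: pres_img_def e_def E_def pres_e_even pres_even_def)
    then have "abs_pres (fa_subst k (fa_subst pres_img y)) = abs_pres y"
      using P.subst_cong[of "\<lambda>i. fa_subst k (pres_img i)" fa_var y] y
      by (simp add: fa_subst_subst k fs_subst fs_img fs_var fa_subst_id)
    \<comment> \<open>This left inverse makes \<open>\<phi>\<close> injective, so no further
      relations hold among the images.\<close>
    then have inj: "\<psi> (\<phi> (abs_pres y)) = abs_pres y"
      using y by (simp add: \<phi>(2) \<psi>(2) fs_subst fs_img)
    have hom0: "\<phi> 0 = 0" "\<psi> 0 = 0"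
      using \<phi>(1) \<psi>(1) unfolding unital_ring_hom_def by (metis add_cancel_right_right)+
    have "fa_subst pres_img y \<in> osym_ideal \<longleftrightarrow> \<phi> (abs_pres y) = 0"
      using y by (simp add: osym_ideal_def \<phi>(2) fs_subst fs_img flip: O.kernel)
    also have "\<dots> \<longleftrightarrow> abs_pres y = 0" using inj hom0 by metis
    also have "\<dots> \<longleftrightarrow> y \<in> fa_ideal pres_rels" using y by (rule P.kernel)
    finally show "fa_subst pres_img y \<in> osym_ideal \<longleftrightarrow> y \<in> fa_ideal pres_rels" .
  qed
qed

end
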